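(* $\Pi_*$ is not homeomorphic to $(\Pi_*/\mathbb{R}_+)\times\mathbb{R}_+$.
   Context: mm-spaces are triples $(X,d_X,\mu_X)$ with $(X,d_X)$ complete separable metric and $\mu_X$ a Borel probability measure, with $X=\operatorname{supp}\mu_X$. $\mathcal{X}$ is the set of their isomorphism classes under measure-preserving isometries of supports. Box distance: $\square(X,Y)$ is the infimum of $\varepsilon\ge0$ such that there exist Borel maps $\varphi,\psi$ from $[0,1)$ pushing Lebesgue measure to $\mu_X,\mu_Y$ and a Borel $I_0$ of measure $\ge1-\varepsilon$ with $|d_X(\varphi(s),\varphi(t))-d_Y(\psi(s),\psi(t))|\le\varepsilon$ on $I_0$. $Y\prec X$ means there is a 1-Lipschitz $f\colon X\to Y$ with $f_*\mu_X=\mu_Y$. A pyramid is a nonempty $\square$-closed subset of $\mathcal{X}$ that is downward closed under $\prec$ and such that any two elements are dominated by a common element. $\Pi$ is the set of pyramids with the (metrizable, compact) topology of weak convergence: $\mathcal{P}_n\to\mathcal{P}$ iff $\square(X,\mathcal{P}_n)\to0$ for $X\in\mathcal{P}$ and $\liminf\square(X,\mathcal{P}_n)>0$ for $X\notin\mathcal{P}$. $\mathbb{R}_+$ acts on $\Pi$ by $t\mathcal{P}=\{(X,t\,d_X,\mu_X):X\in\mathcal{P}\}$. $\Pi_*=\Pi\setminus\mathrm{Fix}(\Pi)$, and $\Pi_*/\mathbb{R}_+$ has the quotient topology. *)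

theory Defs
  imports "HOL-Analysis.Analysis" "HOL-Probability.Probability"
begin

text \<open>Representatives of mm-spaces. Every complete separable metric space has cardinality
at most the continuum, so every mm-space is isomorphic to one whose underlying set is a
subset of the fixed carrier type real (used only as a set, not with its usual metric).
An mm-space is a pair (m, mu) of a metric m on a subset of that type and a measure mu.\<close>

type_synonym mm = "real metric \<times> real measure"

definition borel_sets_of :: "real metric \<Rightarrow> real set set" where
  "borel_sets_of m = sigma_sets (mspace m) {U. openin (mtopology_of m) U}"

definition is_mm :: "mm \<Rightarrow> bool" where
  "is_mm X \<longleftrightarrow>
     (let m = fst X; mu = snd X in
        mcomplete_of m \<and> separable_space (mtopology_of m) \<and>
        prob_space mu \<and> space mu = mspace m \<and> sets mu = borel_sets_of m \<and>
        \<comment> \<open>X = supp mu: every open ball around a point of X has positive measure\<close>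
        (\<forall>x\<in>mspace m. \<forall>r>0. emeasure mu {y \<in> mspace m. mdist m x y < r} > 0))"

definition L01 :: "real measure" where
  "L01 = restrict_space lborel {0..<1}"

definition parametrization :: "mm \<Rightarrow> (real \<Rightarrow> real) \<Rightarrow> bool" where
  "parametrization X phi \<longleftrightarrow> phi \<in> measurable L01 (snd X) \<and> distr L01 (snd X) phi = snd X"

definition box :: "mm \<Rightarrow> mm \<Rightarrow> real" where
  "box X Y = Inf {eps. eps \<ge> 0 \<and>
     (\<exists>phi psi I0. parametrization X phi \<and> parametrization Y psi \<and>
        I0 \<in> sets L01 \<and> measure L01 I0 \<ge> 1 - eps \<and>
        (\<forall>s\<in>I0. \<forall>t\<in>I0.
           \<bar>mdist (fst X) (phi s) (phi t) - mdist (fst Y) (psi s) (psi t)\<bar> \<le> eps))}"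

definition box_set :: "mm \<Rightarrow> mm set \<Rightarrow> real" where
  "box_set X P = Inf (box X ` P)"

definition dominated :: "mm \<Rightarrow> mm \<Rightarrow> bool" where
  "dominated Y X \<longleftrightarrow> (\<exists>f. f \<in> measurable (snd X) (snd Y) \<and>
      (\<forall>x\<in>mspace (fst X). \<forall>x'\<in>mspace (fst X).
          mdist (fst Y) (f x) (f x') \<le> mdist (fst X) x x') \<and>
      distr (snd X) (snd Y) f = snd Y)"

definition pyramid :: "mm set \<Rightarrow> bool" where
  "pyramid P \<longleftrightarrow> P \<noteq> {} \<and> (\<forall>X\<in>P. is_mm X) \<and>
     (\<forall>X. is_mm X \<and> (\<forall>e>0. \<exists>Y\<in>P. box X Y < e) \<longrightarrow> X \<in> P) \<and>
     (\<forall>X\<in>P. \<forall>Y. is_mm Y \<and> dominated Y X \<longrightarrow> Y \<in> P) \<and>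
     (\<forall>X\<in>P. \<forall>Y\<in>P. \<exists>Z\<in>P. dominated X Z \<and> dominated Y Z)"

definition Pyramids :: "mm set set" where
  "Pyramids = {P. pyramid P}"

definition weak_conv :: "(nat \<Rightarrow> mm set) \<Rightarrow> mm set \<Rightarrow> bool" where
  "weak_conv Ps P \<longleftrightarrow>
     (\<forall>X\<in>P. (\<lambda>n. box_set X (Ps n)) \<longlonglongrightarrow> 0) \<and>
     (\<forall>X. is_mm X \<and> X \<notin> P \<longrightarrow> liminf (\<lambda>n. ereal (box_set X (Ps n))) > 0)"

text \<open>The (metrizable, hence sequential) topology of weak convergence on the set of
pyramids: a set is open iff every weakly convergent sequence of pyramids with limit in
the set eventually lies in the set.\<close>
definition weak_open :: "mm set set \<Rightarrow> bool" where
  "weak_open U \<longleftrightarrow> U \<subseteq> Pyramids \<and>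
     (\<forall>P\<in>U. \<forall>Ps. (\<forall>n. Ps n \<in> Pyramids) \<and> weak_conv Ps P \<longrightarrow>
        eventually (\<lambda>n. Ps n \<in> U) sequentially)"

lemma istopology_weak_open: "istopology weak_open"
proof -
  have 1: "weak_open (S \<inter> T)" if "weak_open S" "weak_open T" for S T
    using that unfolding weak_open_def by (auto intro: eventually_conj)
  have 2: "weak_open (\<Union>K)" if a: "\<forall>S\<in>K. weak_open S" for K
    unfolding weak_open_def
  proof (intro conjI ballI allI impI)
    show "\<Union>K \<subseteq> Pyramids" using a unfolding weak_open_def by blast
  next
    fix P Ps assume "P \<in> \<Union>K" and h: "(\<forall>n. Ps n \<in> Pyramids) \<and> weak_conv Ps P"
    then obtain S where "S \<in> K" "P \<in> S" by blast
    with a h have "eventually (\<lambda>n. Ps n \<in> S) sequentially" unfolding weak_open_def by blast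
    then show "eventually (\<lambda>n. Ps n \<in> \<Union>K) sequentially"
      by (rule eventually_mono) (use \<open>S \<in> K\<close> in blast)
  qed
  show ?thesis unfolding istopology_def using 1 2 by blast
qed

definition weak_topology :: "mm set topology" where
  "weak_topology = topology weak_open"

definition scale_mm :: "real \<Rightarrow> mm \<Rightarrow> mm" where
  "scale_mm t X = (metric (mspace (fst X), \<lambda>x y. t * mdist (fst X) x y), snd X)"

definition scale_pyr :: "real \<Rightarrow> mm set \<Rightarrow> mm set" where
  "scale_pyr t P = scale_mm t ` P"

definition Fix_Pi :: "mm set set" where
  "Fix_Pi = {P \<in> Pyramids. \<forall>t>0. scale_pyr t P = P}"

definition Pi_star :: "mm set set" where
  "Pi_star = Pyramids - Fix_Pi"

definition orbit :: "mm set \<Rightarrow> mm set set" where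
  "orbit P = {scale_pyr t P | t. t > 0}"

definition quot_open :: "'a topology \<Rightarrow> ('a \<Rightarrow> 'b) \<Rightarrow> 'b set \<Rightarrow> bool" where
  "quot_open X f U \<longleftrightarrow> U \<subseteq> f ` topspace X \<and> openin X {x \<in> topspace X. f x \<in> U}"

lemma istopology_quot_open: "istopology (quot_open X f)"
proof -
  have 1: "quot_open X f (S \<inter> T)" if "quot_open X f S" "quot_open X f T" for S T
  proof -
    have "{x \<in> topspace X. f x \<in> S \<inter> T} = {x \<in> topspace X. f x \<in> S} \<inter> {x \<in> topspace X. f x \<in> T}"
      by blast
    with that show ?thesis unfolding quot_open_def by auto
  qed
  have 2: "quot_open X f (\<Union>K)" if a: "\<forall>S\<in>K. quot_open X f S" for K
  proof -
    have "{x \<in> topspace X. f x \<in> \<Union>K} = (\<Union>S\<in>K. {x \<in> topspace X. f x \<in> S})" by blast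
    with a show ?thesis unfolding quot_open_def by auto
  qed
  show ?thesis unfolding istopology_def using 1 2 by blast
qed

definition quotient_topology :: "'a topology \<Rightarrow> ('a \<Rightarrow> 'b) \<Rightarrow> 'b topology" where
  "quotient_topology X f = topology (quot_open X f)"

definition Pi_star_top :: "mm set topology" where
  "Pi_star_top = subtopology weak_topology Pi_star"

definition Pi_star_mod_R :: "mm set set topology" where
  "Pi_star_mod_R = quotient_topology Pi_star_top orbit"

end

theory Submission
  imports Defs
begin

text \<open>For \<open>0 < a \<le> b \<le> \<infinity>\<close> let \<open>T(a, b)\<close> (\<open>triangles a b\<close>) be the pyramid of all quotients of three points 0, 1, 2 of mass 1/3
whose distances are at most \<open>a\<close> between 0 and 1 and at most \<open>b\<close> otherwise. The sequence \<open>T(1, n)\<close>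
increases to \<open>T(1, \<infinity>)\<close>, while the rescaled sequence \<open>(1/n) T(1, n) = T(1/n, 1)\<close> decreases to the pyramid
\<open>Q\<close> (\<open>segments 1\<close>) of quotients of two points of masses 2/3 and 1/3 at distance at most 1. So in \<open>\<Pi>\<^sub>*/\<real>\<^sub>+\<close> one sequence
converges to the two distinct orbits of \<open>T(1, \<infinity>)\<close> and of \<open>Q\<close>, and the same happens in the product with \<open>\<real>\<^sub>+\<close>.
In \<open>\<Pi>\<^sub>*\<close>, however, limits of sequences are unique.\<close>

text \<open>Two points carry a single distance, which scaling normalises away; a third point adds a
  second length scale. At unit scale the near pair survives while the third point recedes, and at
  scale \<open>Suc n\<close> the far distance survives while the points 0 and 1 merge, whence the
  masses 2/3 and 1/3. In each limit a finite bound 1 remains, which keeps the limit from being a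
  fixed point, and the orbits of the two limits are told apart by a scale-invariant quantity, the
  number of points. Two obstacles shape the rest. First, \<open>box\<close> is an infimum of reals,
  unspecified on the empty set, so box distances have content only once every mm-space is known to
  have a parametrization by [0, 1); and to be pyramids, the sets of quotients must be shown closed
  under box limits. Second, the topology is given by its open sets, defined through weakly
  convergent sequences. A sequence might a priori converge topologically without converging weakly,
  so uniqueness of topological limits has to be derived from uniqueness of weak limits by exhibiting
  enough open sets.\<close>

section \<open>Parametrizations of mm-spaces\<close>

text \<open>A sequence of bits is coded by a real of the Cantor set, from which the bits can be read off again.\<close>

definition code :: "(nat \<Rightarrow> bool) \<Rightarrow> real" where
  "code b = (\<Sum>i. (if b i then 2 else 0) * (1/3) ^ Suc i)"

definition digit_shift :: "real \<Rightarrow> real" where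
  "digit_shift t = 3 * t - (if t > 1/2 then 2 else 0)"

definition digit :: "nat \<Rightarrow> real \<Rightarrow> bool" where
  "digit i t \<longleftrightarrow> (digit_shift ^^ i) t > 1/2"

lemma summable_code: "summable (\<lambda>i. (if b i then 2 else 0) * (1/3::real) ^ Suc i)"
proof (rule summable_comparison_test')
  show "summable (\<lambda>i. 2 * (1/3::real) ^ Suc i)"
    by (intro summable_mult summable_ignore_initial_segment[of _ 1, simplified] summable_geometric) auto
qed auto

lemma code_bounds: "0 \<le> code b" "code b \<le> 1"
proof -
  show "0 \<le> code b" unfolding code_def by (rule suminf_nonneg[OF summable_code]) auto
  have s: "(\<lambda>i. 2 * (1/3::real) ^ Suc i) sums 1"
    using sums_mult[OF geometric_sums[of "1/3::real"], of "2/3"] by simp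
  have "code b \<le> (\<Sum>i. 2 * (1/3::real) ^ Suc i)" unfolding code_def
    by (rule suminf_le[OF _ summable_code sums_summable[OF s]]) auto
  then show "code b \<le> 1" using sums_unique[OF s] by simp
qed

lemma code_rec: "code b = (if b 0 then 2/3 else 0) + code (\<lambda>i. b (Suc i)) / 3"
proof -
  have "code b = (if b 0 then 2/3 else 0) + (\<Sum>i. (if b (Suc i) then 2 else 0) * (1/3::real) ^ Suc (Suc i))"
    unfolding code_def using suminf_split_head[OF summable_code, of b] by (auto simp: algebra_simps)
  also have "(\<Sum>i. (if b (Suc i) then 2 else 0) * (1/3::real) ^ Suc (Suc i)) = code (\<lambda>i. b (Suc i)) / 3"
    unfolding code_def by (subst suminf_divide[OF summable_code, symmetric]) (auto intro!: suminf_cong)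
  finally show ?thesis .
qed

text \<open>A leading bit puts the code in [2/3, 1], its absence in [0, 1/3]. The threshold 1/2 of
  \<open>digit_shift\<close> and \<open>digit\<close> lies in the gap between them.\<close>

lemma code_gt_half: "code b > 1/2 \<longleftrightarrow> b 0"
  using code_rec[of b] code_bounds[of "\<lambda>i. b (Suc i)"] by (auto split: if_splits)

lemma digit_shift_code: "digit_shift (code b) = code (\<lambda>i. b (Suc i))"
  unfolding digit_shift_def code_gt_half using code_rec[of b] by auto

lemma digit_code: "digit i (code b) = b i"
proof -
  have "(digit_shift ^^ i) (code b) = code (\<lambda>j. b (j + i))" for b
  proof (induction i)
    case (Suc i)
    then show ?case by (simp add: digit_shift_code)
  qed simp
  then show ?thesis using code_gt_half[of "\<lambda>j. b (j + i)"] by (simp add: digit_def)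
qed

lemma measurable_digit [measurable]: "Measurable.pred borel (digit i)"
proof -
  have [measurable]: "digit_shift \<in> borel_measurable borel"
    unfolding digit_shift_def by measurable
  have [measurable]: "(\<lambda>t. (digit_shift ^^ i) t) \<in> borel_measurable borel"
    by (rule measurable_compose_n) measurable
  show ?thesis unfolding digit_def by measurable
qed

section \<open>Borel structure of mm-spaces\<close>

lemma is_mmD:
  assumes "is_mm X"
  shows "mcomplete_of (fst X)" "separable_space (mtopology_of (fst X))" "prob_space (snd X)"
    "space (snd X) = mspace (fst X)" "sets (snd X) = borel_sets_of (fst X)"
    "\<And>x r. x \<in> mspace (fst X) \<Longrightarrow> r > 0 \<Longrightarrow>
        emeasure (snd X) {y \<in> mspace (fst X). mdist (fst X) x y < r} > 0"
  using assms unfolding is_mm_def Let_def by simp_all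

lemma openin_mtopology_of:
  "openin (mtopology_of m) U \<longleftrightarrow>
     U \<subseteq> mspace m \<and> (\<forall>x\<in>U. \<exists>r>0. \<forall>y\<in>mspace m. mdist m x y < r \<longrightarrow> y \<in> U)"
proof -
  interpret Metric_space "mspace m" "mdist m" by simp
  have "mball x r \<subseteq> U \<longleftrightarrow> (\<forall>y\<in>mspace m. mdist m x y < r \<longrightarrow> y \<in> U)" if "x \<in> mspace m" for x r
    using that by auto
  then show ?thesis
    unfolding mtopology_of_def openin_mtopology by (meson subsetD)
qed

lemma openin_sets:
  assumes "is_mm X" "openin (mtopology_of (fst X)) U"
  shows "U \<in> sets (snd X)"
  using assms by (auto simp: is_mmD borel_sets_of_def intro: sigma_sets.Basic)

lemma ball_sets:
  assumes "is_mm X" "x \<in> mspace (fst X)"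
  shows "{y \<in> mspace (fst X). mdist (fst X) x y < r} \<in> sets (snd X)"
proof (rule openin_sets[OF assms(1)])
  have "{y \<in> mspace (fst X). mdist (fst X) x y < r} = mball_of (fst X) x r"
    using assms(2) by auto
  then show "openin (mtopology_of (fst X)) {y \<in> mspace (fst X). mdist (fst X) x y < r}"
    by (simp add: mball_of_def mtopology_of_def Metric_space.openin_mball)
qed

lemma mm_nonempty: "is_mm X \<Longrightarrow> mspace (fst X) \<noteq> {}"
  using prob_space.not_empty[of "snd X"] by (auto simp: is_mmD)

lemma dense_sequence:
  assumes "is_mm X"
  obtains x :: "nat \<Rightarrow> real" where "\<And>k. x k \<in> mspace (fst X)"
    "\<And>y r. y \<in> mspace (fst X) \<Longrightarrow> r > 0 \<Longrightarrow> \<exists>k. mdist (fst X) y (x k) < r"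
proof -
  obtain S where S: "countable S" "S \<subseteq> mspace (fst X)"
      "mtopology_of (fst X) closure_of S = mspace (fst X)"
    using is_mmD(2)[OF assms] unfolding separable_space_def by auto
  have "S \<noteq> {}" using S(3) mm_nonempty[OF assms] by auto
  show thesis
  proof (rule that[of "from_nat_into S"])
    show "from_nat_into S k \<in> mspace (fst X)" for k
      using from_nat_into[OF \<open>S \<noteq> {}\<close>] S(2) by blast
    fix y r assume "y \<in> mspace (fst X)" "(r::real) > 0"
    then obtain z where "z \<in> S" "mdist (fst X) y z < r"
      using S(3) unfolding mtopology_of_def
      by (auto simp: Metric_space.metric_closure_of[OF Metric_space_mspace_mdist]
          Metric_space.in_mball[OF Metric_space_mspace_mdist])
    then show "\<exists>k. mdist (fst X) y (from_nat_into S k) < r"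
      using from_nat_into_surj[OF S(1), of z] by auto
  qed
qed

text \<open>A point is coded by the bits telling which rational balls around a dense sequence contain it; the
inverse takes, for each radius, the first center that fits, and then the limit of these centers.\<close>

lemma borel_coding:
  assumes X: "is_mm X"
  obtains h g :: "real \<Rightarrow> real" where "h \<in> borel_measurable (snd X)" "g \<in> measurable borel (snd X)"
    "\<And>y. y \<in> mspace (fst X) \<Longrightarrow> g (h y) = (y::real)"
proof -
  let ?M = "mspace (fst X)" and ?d = "mdist (fst X)"
  interpret Metric_space ?M ?d by simp
  obtain x :: "nat \<Rightarrow> real" where x: "\<And>k. x k \<in> ?M"
    and dense: "\<And>y r. y \<in> ?M \<Longrightarrow> r > 0 \<Longrightarrow> \<exists>k. ?d y (x k) < r"
    using dense_sequence[OF X] by blast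
  define bits where "bits y i = (case prod_decode i of (n, k) \<Rightarrow> ?d y (x k) < inverse (real (Suc n)))" for y i
  define h where "h y = code (bits y)" for y
  define idx where "idx n t = (LEAST k. digit (prod_encode (n, k)) t)" for n t
  \<comment> \<open>The Cauchy condition uses only countable quantifiers, so \<open>C\<close> is a
    measurable predicate. Where it fails, \<open>g\<close> takes the default \<open>x 0\<close> and
    thus always has values in the space.\<close>
  define C where "C t \<longleftrightarrow> (\<forall>m. \<exists>N. \<forall>i\<ge>N. \<forall>j\<ge>N. ?d (x (idx i t)) (x (idx j t)) < inverse (real (Suc m)))" for t
  define g where "g t = (if C t then (SOME l. limitin mtopology (\<lambda>n. x (idx n t)) l sequentially) else x 0)" for t
  have [measurable]: "idx n \<in> measurable borel (count_space UNIV)" for n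
    unfolding idx_def by measurable
  have [measurable]: "Measurable.pred borel C"
    unfolding C_def by measurable
  have lim: "limitin mtopology (\<lambda>n. x (idx n t)) (g t) sequentially" if "C t" for t
  proof -
    have "MCauchy (\<lambda>n. x (idx n t))"
      unfolding MCauchy_def
    proof (intro conjI allI impI)
      fix e :: real assume "e > 0"
      then obtain m where m: "inverse (real (Suc m)) < e" using reals_Archimedean by blast
      then show "\<exists>N. \<forall>n n'. N \<le> n \<longrightarrow> N \<le> n' \<longrightarrow> ?d (x (idx n t)) (x (idx n' t)) < e"
        using that unfolding C_def by (meson less_trans)
    qed (use x in auto)
    then have "\<exists>l. limitin mtopology (\<lambda>n. x (idx n t)) l sequentially"
      using is_mmD(1)[OF X] by (auto simp: mcomplete_of_def mcomplete_def)
    then show ?thesis unfolding g_def using that by (auto intro: someI_ex)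
  qed
  then have gM: "g t \<in> ?M" for t
    by (cases "C t") (use limitin_mspace in blast, use x in \<open>simp add: g_def\<close>)
  show thesis
  proof (rule that[of h g])
    have [measurable]: "Measurable.pred (snd X) (\<lambda>y. bits y i)" for i
    proof -
      obtain n k where i: "prod_decode i = (n, k)" by fastforce
      have "{y \<in> space (snd X). bits y i} = {z \<in> ?M. ?d (x k) z < inverse (real (Suc n))}"
        by (auto simp: bits_def i is_mmD(4)[OF X] commute)
      then show ?thesis
        using ball_sets[OF X x] by (simp add: pred_def)
    qed
    have "h = (\<lambda>y. \<Sum>i. (if bits y i then 2 else 0) * (1/3) ^ Suc i)"
      by (auto simp: h_def code_def)
    also have "\<dots> \<in> borel_measurable (snd X)"
      by measurable
    finally show "h \<in> borel_measurable (snd X)" .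
    show "g (h y) = y" if y: "y \<in> ?M" for y
    proof -
      have idx: "?d y (x (idx n (h y))) < inverse (real (Suc n))" for n
      proof -
        have "\<exists>k. ?d y (x k) < inverse (real (Suc n))" using dense[OF y] by simp
        then show ?thesis
          unfolding idx_def h_def digit_code bits_def by (auto intro: LeastI_ex)
      qed
      have lim_y: "limitin mtopology (\<lambda>n. x (idx n (h y))) y sequentially"
        unfolding limitin_metric
      proof (intro conjI allI impI y)
        fix e :: real assume "e > 0"
        then have "\<forall>\<^sub>F n in sequentially. inverse (real (Suc n)) < e"
          using LIMSEQ_inverse_real_of_nat order_tendstoD(2) by blast
        then show "\<forall>\<^sub>F n in sequentially. x (idx n (h y)) \<in> ?M \<and> ?d (x (idx n (h y))) y < e"
          by eventually_elim (use x idx in \<open>auto simp: commute[of _ y] intro: less_trans\<close>)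
      qed
      have "C (h y)"
        using convergent_imp_MCauchy[OF _ lim_y] x unfolding C_def MCauchy_def by fastforce
      then show ?thesis
        using lim lim_y limitin_metric_unique by fastforce
    qed
    show "g \<in> measurable borel (snd X)"
    proof (rule measurable_sigma_sets[OF is_mmD(5)[OF X, unfolded borel_sets_of_def]])
      show "{U. openin (mtopology_of (fst X)) U} \<subseteq> Pow ?M"
        using openin_subset by fastforce
      show "g \<in> space borel \<rightarrow> ?M" using gM by auto
      fix U assume "U \<in> {U. openin (mtopology_of (fst X)) U}"
      then have U: "openin mtopology U" by (simp add: mtopology_of_def)
      \<comment> \<open>Membership of the limit in an open set, in countable terms: balls of one
        fixed radius around all late centers lie inside \<open>U\<close>. Asking only that late
        centers lie in \<open>U\<close> would also admit limits on its boundary.\<close>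
      have *: "g t \<in> U \<longleftrightarrow> (\<exists>m N. \<forall>n\<ge>N. mball (x (idx n t)) (inverse (real (Suc m))) \<subseteq> U)"
        if C: "C t" for t
      proof
        assume "g t \<in> U"
        then obtain r where r: "r > 0" "mball (g t) r \<subseteq> U"
          using U unfolding openin_mtopology by blast
        obtain m where m: "inverse (real (Suc m)) < r / 2"
          using reals_Archimedean[of "r/2"] r by auto
        obtain N where N: "\<And>n. n \<ge> N \<Longrightarrow> ?d (x (idx n t)) (g t) < r / 2"
          using lim[OF C] r unfolding limitin_metric eventually_sequentially
          by (meson half_gt_zero)
        have "mball (x (idx n t)) (inverse (real (Suc m))) \<subseteq> mball (g t) r" if "n \<ge> N" for n
          using N[OF that] m by (intro mball_subset gM) auto
        with r show "\<exists>m N. \<forall>n\<ge>N. mball (x (idx n t)) (inverse (real (Suc m))) \<subseteq> U" by blast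
      next
        assume "\<exists>m N. \<forall>n\<ge>N. mball (x (idx n t)) (inverse (real (Suc m))) \<subseteq> U"
        then obtain m N where N: "\<And>n. n \<ge> N \<Longrightarrow> mball (x (idx n t)) (inverse (real (Suc m))) \<subseteq> U" by blast
        obtain N' where N': "\<And>n. n \<ge> N' \<Longrightarrow> ?d (x (idx n t)) (g t) < inverse (real (Suc m))"
          using lim[OF C] unfolding limitin_metric eventually_sequentially
          by (meson inverse_positive_iff_positive of_nat_0_less_iff zero_less_Suc)
        have "g t \<in> mball (x (idx (max N N') t)) (inverse (real (Suc m)))"
          using N'[of "max N N'"] x gM by auto
        then show "g t \<in> U" using N[of "max N N'"] by auto
      qed
      have eq: "g t \<in> U \<longleftrightarrow> (if C t then \<exists>m N. \<forall>n\<ge>N. mball (x (idx n t)) (inverse (real (Suc m))) \<subseteq> U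
          else x 0 \<in> U)" for t
        using *[of t] by (cases "C t") (simp_all only: if_True if_False, simp add: g_def)
      \<comment> \<open>The centers are indexed by naturals, and on \<open>count_space UNIV\<close>
        every predicate is measurable.\<close>
      have [measurable]: "Measurable.pred borel (\<lambda>t. mball (x (idx n t)) r \<subseteq> U)" for n r
        by (rule measurable_compose[of "idx n" borel "count_space UNIV" "\<lambda>k. mball (x k) r \<subseteq> U"]) auto
      have "g -` U \<inter> space borel = {t \<in> space borel. if C t
          then \<exists>m N. \<forall>n\<ge>N. mball (x (idx n t)) (inverse (real (Suc m))) \<subseteq> U else x 0 \<in> U}"
        using eq by blast
      also have "\<dots> \<in> sets borel"
        by measurable
      finally show "g -` U \<inter> space borel \<in> sets borel" .
    qed
  qed
qed

section \<open>Existence of a parametrization by [0, 1)\<close>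

lemma space_L01: "space L01 = {0..<1}"
  by (simp add: L01_def space_restrict_space)

lemma prob_space_L01: "prob_space L01"
  by (auto simp add: L01_def emeasure_restrict_space space_restrict_space intro!: prob_spaceI)

text \<open>The quantile function of the distribution of the code, composed with the decoding map.\<close>

lemma parametrization_exists:
  assumes X: "is_mm X"
  obtains phi where "parametrization X phi"
proof -
  obtain h g :: "real \<Rightarrow> real" where h[measurable]: "h \<in> borel_measurable (snd X)"
    and g[measurable]: "g \<in> measurable borel (snd X)"
    and gh: "\<And>y. y \<in> mspace (fst X) \<Longrightarrow> g (h y) = y"
    using borel_coding[OF X] by blast
  interpret prob_space "snd X" using X by (rule is_mmD)
  let ?N = "distr (snd X) borel h"
  interpret N: cdf_distribution ?N
    by (simp add: cdf_distribution_def real_distribution_def real_distribution_axioms_def prob_space_distr)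
  let ?O = "restrict_space lborel {0<..<1::real}"
  \<comment> \<open>\<open>N.I\<close> is the pseudo-inverse of the distribution function,
    considered on the open interval. The value at the single point 0 is arbitrary, since that point
    is Lebesgue-null.\<close>
  define q where "q t = (if 0 < t then N.I t else 0)" for t
  have q[measurable]: "q \<in> borel_measurable L01"
  proof -
    have "(\<lambda>t. if t \<in> {0<..<1} then N.I t else 0) \<in> borel_measurable borel"
      using N.measurable_CI by (subst (asm) borel_measurable_restrict_space_iff) (auto elim!: measurable_cong[THEN iffD1, rotated])
    then have "(\<lambda>t. if t \<in> {0<..<1} then N.I t else 0) \<in> borel_measurable L01"
      by (simp add: L01_def measurable_restrict_space1)
    then show ?thesis
      by (rule measurable_cong[THEN iffD1, rotated]) (auto simp: q_def space_L01)
  qed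
  have "distr L01 borel q = ?N"
  proof (rule measure_eqI)
    fix A assume "A \<in> sets (distr L01 borel q)"
    then have A[measurable]: "A \<in> sets borel" by simp
    have "emeasure ?N A = emeasure (distr ?O borel N.I) A"
      by (simp add: N.distr_I_eq_M)
    also have "\<dots> = emeasure ?O (N.I -` A \<inter> {0<..<1})"
      by (subst emeasure_distr) (auto simp: space_restrict_space)
    also have "\<dots> = emeasure lborel (N.I -` A \<inter> {0<..<1})"
      by (subst emeasure_restrict_space) auto
    also have "N.I -` A \<inter> {0<..<1} = (q -` A \<inter> {0..<1}) - {0}"
      by (auto simp: q_def)
    also have "emeasure lborel \<dots> = emeasure lborel (q -` A \<inter> {0..<1})"
    proof (rule emeasure_Diff_null_set)
      have "q -` A \<inter> space L01 \<in> sets L01" by measurable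
      then show "q -` A \<inter> {0..<1} \<in> sets lborel"
        by (auto simp: space_L01 L01_def sets_restrict_space)
    qed auto
    also have "\<dots> = emeasure L01 (q -` A \<inter> {0..<1})"
      unfolding L01_def by (subst emeasure_restrict_space) auto
    also have "\<dots> = emeasure (distr L01 borel q) A"
      by (subst emeasure_distr) (auto simp: space_L01)
    finally show "emeasure (distr L01 borel q) A = emeasure ?N A" by simp
  qed simp
  then have "distr L01 (snd X) (g \<circ> q) = distr ?N (snd X) g"
    using distr_distr[OF g q] by simp
  also have "\<dots> = distr (snd X) (snd X) (g \<circ> h)"
    by (rule distr_distr) auto
  also have "\<dots> = distr (snd X) (snd X) (\<lambda>x. x)"
    by (rule distr_cong) (auto simp: gh is_mmD[OF X])
  also have "\<dots> = snd X" by simp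
  finally have "parametrization X (g \<circ> q)"
    unfolding parametrization_def by (auto intro: measurable_comp[OF q g])
  then show thesis by (rule that)
qed

section \<open>Box distance\<close>

definition box_bounds :: "mm \<Rightarrow> mm \<Rightarrow> real set" where
  "box_bounds X Y = {eps. eps \<ge> 0 \<and>
     (\<exists>phi psi I0. parametrization X phi \<and> parametrization Y psi \<and>
        I0 \<in> sets L01 \<and> measure L01 I0 \<ge> 1 - eps \<and>
        (\<forall>s\<in>I0. \<forall>t\<in>I0.
           \<bar>mdist (fst X) (phi s) (phi t) - mdist (fst Y) (psi s) (psi t)\<bar> \<le> eps))}"

lemma box_eq_Inf: "box X Y = Inf (box_bounds X Y)"
  by (simp add: box_def box_bounds_def)

lemma bdd_below_box_bounds: "bdd_below (box_bounds X Y)"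
  by (rule bdd_belowI[of _ 0]) (simp add: box_bounds_def)

text \<open>With the empty set as \<open>I0\<close> the bound 1 is always admissible, provided
  parametrizations exist. This makes \<open>box\<close> a genuine infimum.\<close>

lemma box_bounds_nonempty:
  assumes "is_mm X" "is_mm Y"
  shows "box_bounds X Y \<noteq> {}"
proof -
  obtain phi psi where "parametrization X phi" "parametrization Y psi"
    using parametrization_exists assms by metis
  then have "1 \<in> box_bounds X Y" by (auto simp: box_bounds_def intro!: exI[of _ "{}"])
  then show ?thesis by blast
qed

lemma box_nonneg:
  assumes "is_mm X" "is_mm Y"
  shows "0 \<le> box X Y"
  unfolding box_eq_Inf
  by (rule cInf_greatest[OF box_bounds_nonempty[OF assms]]) (simp add: box_bounds_def)

lemma box_self:
  assumes "is_mm X"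
  shows "box X X = 0"
proof -
  obtain phi where "parametrization X phi"
    using parametrization_exists[OF assms] by blast
  moreover have "space L01 \<in> sets L01" "measure L01 (space L01) = 1"
    using prob_space.prob_space[OF prob_space_L01] by auto
  ultimately have "0 \<in> box_bounds X X"
    unfolding box_bounds_def by fastforce
  then have "box X X \<le> 0"
    unfolding box_eq_Inf by (intro cInf_lower bdd_below_box_bounds)
  then show ?thesis using box_nonneg[OF assms assms] by simp
qed

lemma box_less_witness:
  assumes "is_mm X" "is_mm Y" "box X Y < e"
  obtains eps phi psi I0 where "0 \<le> eps" "eps < e" "parametrization X phi" "parametrization Y psi"
    "I0 \<in> sets L01" "measure L01 I0 \<ge> 1 - eps"
    "\<And>s t. s \<in> I0 \<Longrightarrow> t \<in> I0 \<Longrightarrow>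
       \<bar>mdist (fst X) (phi s) (phi t) - mdist (fst Y) (psi s) (psi t)\<bar> \<le> eps"
proof -
  obtain eps where "eps \<in> box_bounds X Y" "eps < e"
    using cInf_lessD[OF box_bounds_nonempty[OF assms(1,2)]] assms(3) unfolding box_eq_Inf by blast
  then show thesis using that unfolding box_bounds_def by blast
qed

lemma parametrization_space:
  assumes "parametrization X phi" "is_mm X" "I0 \<in> sets L01" "s \<in> I0"
  shows "phi s \<in> mspace (fst X)"
proof -
  have "phi \<in> measurable L01 (snd X)" using assms(1) unfolding parametrization_def by (rule conjunct1)
  moreover have "s \<in> space L01" using sets.sets_into_space[OF assms(3)] assms(4) by (rule subsetD)
  ultimately show ?thesis using measurable_space is_mmD(4)[OF assms(2)] by metis
qed

lemma measure_parametrization: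
  assumes "parametrization X phi" "A \<in> sets (snd X)"
  shows "phi -` A \<inter> {0..<1} \<in> sets L01" "measure L01 (phi -` A \<inter> {0..<1}) = measure (snd X) A"
proof -
  have "phi \<in> measurable L01 (snd X)" "distr L01 (snd X) phi = snd X"
    using assms unfolding parametrization_def by auto
  then show "phi -` A \<inter> {0..<1} \<in> sets L01" "measure L01 (phi -` A \<inter> {0..<1}) = measure (snd X) A"
    using assms measurable_sets[of phi L01 "snd X" A] measure_distr[of phi L01 "snd X" A]
    by (simp_all add: space_L01)
qed

text \<open>The complement of \<open>I0\<close> has mass at most \<open>eps\<close>, too little to
  contain the whole preimage of \<open>A\<close>.\<close>

lemma parametrization_meets:
  assumes "parametrization X phi" "A \<in> sets (snd X)"
    and I0: "I0 \<in> sets L01" "measure L01 I0 \<ge> 1 - eps" and "measure (snd X) A > eps"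
  obtains s where "s \<in> I0" "phi s \<in> A"
proof -
  interpret L: prob_space L01 by (rule prob_space_L01)
  let ?B = "phi -` A \<inter> {0..<1}"
  have "?B \<inter> I0 \<noteq> {}"
  proof
    assume "?B \<inter> I0 = {}"
    then have "measure L01 (?B \<union> I0) = measure L01 ?B + measure L01 I0"
      using measure_parametrization[OF assms(1,2)] I0 by (intro L.finite_measure_Union) auto
    then show False
      using L.prob_le_1[of "?B \<union> I0"] measure_parametrization[OF assms(1,2)] assms by simp
  qed
  then show thesis using that by blast
qed

lemma measure_close:
  assumes "A \<in> sets L01" "B \<in> sets L01" "I0 \<in> sets L01" "measure L01 I0 \<ge> 1 - eps"
    and AB: "A \<inter> I0 = B \<inter> I0"
  shows "\<bar>measure L01 A - measure L01 B\<bar> \<le> eps"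
proof -
  interpret L: prob_space L01 by (rule prob_space_L01)
  have *: "measure L01 (A \<inter> I0) \<le> measure L01 A \<and> measure L01 A \<le> measure L01 (A \<inter> I0) + eps"
    if A: "A \<in> sets L01" for A
  proof
    show "measure L01 (A \<inter> I0) \<le> measure L01 A"
      using A assms by (intro L.finite_measure_mono) auto
    have "measure L01 A \<le> measure L01 ((A \<inter> I0) \<union> (space L01 - I0))"
      using A assms sets.sets_into_space[OF A] by (intro L.finite_measure_mono) auto
    also have "\<dots> \<le> measure L01 (A \<inter> I0) + measure L01 (space L01 - I0)"
      using A assms by (intro measure_Un_le) auto
    also have "measure L01 (space L01 - I0) \<le> eps"
      using assms by (simp add: L.prob_compl)
    finally show "measure L01 A \<le> measure L01 (A \<inter> I0) + eps" by simp
  qed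
  show ?thesis using *[OF assms(1)] *[OF assms(2)] unfolding AB abs_le_iff by auto
qed

section \<open>Finite metric spaces\<close>

lemma finite_separated:
  assumes "finite S" "S \<subseteq> mspace m"
  obtains e where "e > 0" "\<And>x y. x \<in> S \<Longrightarrow> y \<in> S \<Longrightarrow> x \<noteq> y \<Longrightarrow> e \<le> mdist m x y"
proof -
  \<comment> \<open>The extra 1 keeps the minimum defined when \<open>S\<close> has at most one
    point.\<close>
  let ?T = "insert 1 ((\<lambda>(x, y). mdist m x y) ` {(x, y) \<in> S \<times> S. x \<noteq> y})"
  have fin: "finite ?T"
    using finite_subset[of "{(x, y) \<in> S \<times> S. x \<noteq> y}" "S \<times> S"] assms(1) by auto
  have "mdist m x y > 0" if "x \<in> S" "y \<in> S" "x \<noteq> y" for x y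
    using that assms(2) by (intro Metric_space.mdist_pos_less[OF Metric_space_mspace_mdist]) auto
  then have "Min ?T > 0" using fin by (subst Min_gr_iff) auto
  then show thesis
    using fin by (intro that[of "Min ?T"]) (auto intro!: Min_le)
qed

lemma openin_finite_metric:
  assumes "finite (mspace m)" "A \<subseteq> mspace m"
  shows "openin (mtopology_of m) A"
proof -
  obtain e where e: "e > 0" "\<And>x y. x \<in> mspace m \<Longrightarrow> y \<in> mspace m \<Longrightarrow> x \<noteq> y \<Longrightarrow> e \<le> mdist m x y"
    using finite_separated[OF assms(1) subset_refl] by blast
  then have "\<forall>y\<in>mspace m. mdist m x y < e \<longrightarrow> y \<in> A" if "x \<in> A" for x
    using that assms(2) by force
  then show ?thesis
    unfolding openin_mtopology_of using assms(2) e(1) by auto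
qed

lemma sets_finite_metric:
  assumes "finite (mspace m)"
  shows "borel_sets_of m = Pow (mspace m)"
proof
  show "borel_sets_of m \<subseteq> Pow (mspace m)"
    unfolding borel_sets_of_def
    using sigma_sets_into_sp[of "{U. openin (mtopology_of m) U}" "mspace m"] openin_subset[of "mtopology_of m"]
    by auto
  show "Pow (mspace m) \<subseteq> borel_sets_of m"
    unfolding borel_sets_of_def using openin_finite_metric[OF assms] by (auto intro: sigma_sets.Basic)
qed

section \<open>Pyramids of quotients of a finite weighted set\<close>

definition finite_mm :: "real set \<Rightarrow> (real \<Rightarrow> real) \<Rightarrow> (real \<Rightarrow> real \<Rightarrow> real) \<Rightarrow> mm" where
  "finite_mm K w d = (metric (K, d), point_measure K (\<lambda>i. ennreal (w i)))"

text \<open>\<open>F\<close> labels points of \<open>X\<close> by elements of \<open>K\<close> so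
  that the measure is the push-forward of the weights. No metric on \<open>K\<close> enters, so one
  labelling can be tested against any distance bounds.\<close>

definition fits :: "real set \<Rightarrow> (real \<Rightarrow> real) \<Rightarrow> mm \<Rightarrow> (real \<Rightarrow> real) \<Rightarrow> bool" where
  "fits K w X F \<longleftrightarrow> F \<in> K \<rightarrow> mspace (fst X) \<and>
     (\<forall>A\<in>sets (snd X). measure (snd X) A = (\<Sum>i\<in>{i\<in>K. F i \<in> A}. w i))"

text \<open>The bounds \<open>D\<close> need not form a metric and may be infinite, which admits
  pyramids without a largest element such as \<open>triangles 1 \<infinity>\<close>.\<close>

definition gen :: "real set \<Rightarrow> (real \<Rightarrow> real) \<Rightarrow> (real \<Rightarrow> real \<Rightarrow> ereal) \<Rightarrow> mm set" where
  "gen K w D = {X. is_mm X \<and> (\<exists>F. fits K w X F \<and>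
     (\<forall>i\<in>K. \<forall>j\<in>K. ereal (mdist (fst X) (F i) (F j)) \<le> D i j))}"

locale weights =
  fixes K :: "real set" and w :: "real \<Rightarrow> real"
  assumes finite_K: "finite K" and pos: "\<And>i. i \<in> K \<Longrightarrow> 0 < w i" and total: "sum w K = 1"
begin

context
  fixes d assumes d: "Metric_space K d"
begin

lemma mspace_finite_mm: "mspace (fst (finite_mm K w d)) = K"
  and mdist_finite_mm: "mdist (fst (finite_mm K w d)) = d"
  using d by (simp_all add: finite_mm_def Metric_space.mspace_metric Metric_space.mdist_metric)

lemma sets_finite_mm: "sets (snd (finite_mm K w d)) = Pow K"
  by (simp add: finite_mm_def sets_point_measure)

lemma emeasure_finite_mm: "A \<subseteq> K \<Longrightarrow> emeasure (snd (finite_mm K w d)) A = ennreal (sum w A)"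
  unfolding finite_mm_def using finite_K pos
  by (simp add: emeasure_point_measure_finite sum_ennreal subset_eq less_imp_le)

lemma is_mm_finite_mm: "is_mm (finite_mm K w d)"
proof -
  let ?X = "finite_mm K w d"
  have "finite (mspace (fst ?X))" by (simp add: mspace_finite_mm finite_K)
  then have comp: "compact_space (mtopology_of (fst ?X))"
    by (simp add: compact_space_def finite_imp_compactin)
  interpret M: Metric_space "mspace (fst ?X)" "mdist (fst ?X)" by simp
  have "mcomplete_of (fst ?X)"
    using M.compact_space_imp_mcomplete comp by (simp add: mcomplete_of_def mtopology_of_def)
  moreover have "separable_space (mtopology_of (fst ?X))"
    unfolding separable_space_def
    by (rule exI[of _ "mspace (fst ?X)"])
      (use closure_of_topspace[of "mtopology_of (fst ?X)"] in \<open>simp add: mspace_finite_mm finite_K countable_finite\<close>)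
  moreover have sp: "space (snd ?X) = mspace (fst ?X)"
    by (simp add: finite_mm_def space_point_measure Metric_space.mspace_metric[OF d])
  moreover have "prob_space (snd ?X)"
    by (rule prob_spaceI) (simp add: sp mspace_finite_mm emeasure_finite_mm total)
  moreover have "sets (snd ?X) = borel_sets_of (fst ?X)"
    by (simp add: sets_finite_metric mspace_finite_mm finite_K sets_finite_mm)
  moreover have "emeasure (snd ?X) {y \<in> mspace (fst ?X). mdist (fst ?X) x y < r} > 0"
    if "x \<in> mspace (fst ?X)" "r > 0" for x r
  proof -
    have "x \<in> {y \<in> mspace (fst ?X). mdist (fst ?X) x y < r}" using that by simp
    then have "sum w {y \<in> mspace (fst ?X). mdist (fst ?X) x y < r} > 0"
      using pos finite_K by (intro sum_pos) (auto simp: mspace_finite_mm)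
    then show ?thesis by (subst emeasure_finite_mm) (auto simp: mspace_finite_mm)
  qed
  ultimately show ?thesis unfolding is_mm_def Let_def by blast
qed

lemma fits_finite_mm: "fits K w (finite_mm K w d) (\<lambda>i. i)"
proof -
  have "measure (snd (finite_mm K w d)) A = sum w {i \<in> K. i \<in> A}" if "A \<subseteq> K" for A
  proof -
    have "{i \<in> K. i \<in> A} = A" using that by auto
    then show ?thesis using that pos
      by (simp add: measure_def emeasure_finite_mm sum_nonneg subset_eq less_imp_le)
  qed
  then show ?thesis by (simp add: fits_def mspace_finite_mm sets_finite_mm)
qed

lemma dominated_finite_mm:
  assumes X: "is_mm X" and F: "fits K w X F"
    and le: "\<And>i j. i \<in> K \<Longrightarrow> j \<in> K \<Longrightarrow> mdist (fst X) (F i) (F j) \<le> d i j"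
  shows "dominated X (finite_mm K w d)"
proof -
  let ?Z = "finite_mm K w d"
  interpret prob_space "snd X" using X by (rule is_mmD)
  have meas: "F \<in> measurable (snd ?Z) (snd X)"
    using F by (simp add: fits_def finite_mm_def is_mmD[OF X])
  have "distr (snd ?Z) (snd X) F = snd X"
  proof (rule measure_eqI)
    fix A assume "A \<in> sets (distr (snd ?Z) (snd X) F)"
    then have A: "A \<in> sets (snd X)" by simp
    have sp: "space (snd ?Z) = K" by (simp add: finite_mm_def space_point_measure)
    have "emeasure (distr (snd ?Z) (snd X) F) A = ennreal (sum w (F -` A \<inter> K))"
      by (simp add: emeasure_distr[OF meas A] sp emeasure_finite_mm)
    also have "F -` A \<inter> K = {i\<in>K. F i \<in> A}" by auto
    also have "ennreal (sum w {i\<in>K. F i \<in> A}) = emeasure (snd X) A"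
      using F A by (simp add: fits_def emeasure_eq_measure)
    finally show "emeasure (distr (snd ?Z) (snd X) F) A = emeasure (snd X) A" .
  qed simp
  then show ?thesis
    unfolding dominated_def using meas le by (auto simp: mspace_finite_mm mdist_finite_mm)
qed

end

text \<open>Full support forces this: a point outside the finite image of \<open>F\<close> would
  have a small ball that contains no labelled point, hence has measure 0.\<close>

lemma fits_surj:
  assumes X: "is_mm X" and F: "fits K w X F"
  shows "mspace (fst X) = F ` K"
proof
  show "F ` K \<subseteq> mspace (fst X)" using F by (auto simp: fits_def)
  show "mspace (fst X) \<subseteq> F ` K"
  proof (rule subsetI, rule ccontr)
    fix x assume x: "x \<in> mspace (fst X)" "x \<notin> F ` K"
    have "finite (insert x (F ` K))" "insert x (F ` K) \<subseteq> mspace (fst X)"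
      using finite_K x F by (auto simp: fits_def)
    from finite_separated[OF this] obtain r where r: "r > 0"
      "\<And>y z. y \<in> insert x (F ` K) \<Longrightarrow> z \<in> insert x (F ` K) \<Longrightarrow> y \<noteq> z \<Longrightarrow> r \<le> mdist (fst X) y z"
      by blast
    let ?B = "{y \<in> mspace (fst X). mdist (fst X) x y < r}"
    interpret prob_space "snd X" using X by (rule is_mmD)
    have none: "{i\<in>K. F i \<in> ?B} = {}" using r(2)[of x] x by fastforce
    have "measure (snd X) ?B = sum w {i\<in>K. F i \<in> ?B}"
      using F ball_sets[OF X x(1)] unfolding fits_def by blast
    then have "measure (snd X) ?B = 0" unfolding none by simp
    then have "emeasure (snd X) ?B = 0" by (simp add: emeasure_eq_measure)
    then show False using is_mmD(6)[OF X x(1) r(1)] by simp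
  qed
qed

lemma fits_sets:
  assumes X: "is_mm X" and F: "fits K w X F"
  shows "sets (snd X) = Pow (mspace (fst X))"
  using fits_surj[OF assms] finite_K by (simp add: is_mmD[OF X] sets_finite_metric)

lemma gen_dominated:
  assumes X: "X \<in> gen K w D" and Y: "is_mm Y" "dominated Y X"
  shows "Y \<in> gen K w D"
proof -
  obtain F where Xm: "is_mm X" and F: "fits K w X F"
      "\<And>i j. i \<in> K \<Longrightarrow> j \<in> K \<Longrightarrow> ereal (mdist (fst X) (F i) (F j)) \<le> D i j"
    using X unfolding gen_def by blast
  obtain f where f: "f \<in> measurable (snd X) (snd Y)" "distr (snd X) (snd Y) f = snd Y"
      "\<And>x x'. x \<in> mspace (fst X) \<Longrightarrow> x' \<in> mspace (fst X) \<Longrightarrow>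
          mdist (fst Y) (f x) (f x') \<le> mdist (fst X) x x'"
    using Y(2) unfolding dominated_def by blast
  have Fm: "F i \<in> mspace (fst X)" if "i \<in> K" for i using F(1) that by (auto simp: fits_def)
  have "measure (snd Y) A = (\<Sum>i\<in>{i\<in>K. (f \<circ> F) i \<in> A}. w i)" if A: "A \<in> sets (snd Y)" for A
  proof -
    have "measure (snd Y) A = measure (snd X) (f -` A \<inter> space (snd X))"
      using measure_distr[OF f(1) A] f(2) by simp
    also have "\<dots> = (\<Sum>i\<in>{i\<in>K. F i \<in> f -` A \<inter> space (snd X)}. w i)"
      using F(1) measurable_sets[OF f(1) A] unfolding fits_def by blast
    also have "{i\<in>K. F i \<in> f -` A \<inter> space (snd X)} = {i\<in>K. (f \<circ> F) i \<in> A}"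
      using Fm by (auto simp: is_mmD[OF Xm])
    finally show ?thesis .
  qed
  moreover have "f \<circ> F \<in> K \<rightarrow> mspace (fst Y)"
    using Fm measurable_space[OF f(1)] by (auto simp: is_mmD[OF Xm] is_mmD[OF Y(1)])
  ultimately have "fits K w Y (f \<circ> F)" by (simp add: fits_def)
  moreover have "ereal (mdist (fst Y) ((f \<circ> F) i) ((f \<circ> F) j)) \<le> D i j" if "i \<in> K" "j \<in> K" for i j
    using F(2)[OF that] f(3)[OF Fm[OF that(1)] Fm[OF that(2)]]
    by (metis comp_apply ereal_less_eq(3) order_trans)
  ultimately show ?thesis using Y(1) unfolding gen_def by blast
qed

text \<open>Otherwise more than \<open>card K\<close> separated points of positive mass would be seen by a close space
with at most \<open>card K\<close> points.\<close>

lemma finite_of_box_limit: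
  assumes X: "is_mm X" and lim: "\<And>e. e > 0 \<Longrightarrow> \<exists>Y\<in>gen K w D. box X Y < e"
  shows "finite (mspace (fst X))"
proof -
  let ?d = "mdist (fst X)"
  interpret prob_space "snd X" using X by (rule is_mmD)
  interpret M: Metric_space "mspace (fst X)" ?d by simp
  have "card S \<le> card K" if S: "S \<subseteq> mspace (fst X)" "finite S" for S
  proof -
    obtain r where r: "r > 0" "\<And>x y. x \<in> S \<Longrightarrow> y \<in> S \<Longrightarrow> x \<noteq> y \<Longrightarrow> r \<le> ?d x y"
      using finite_separated[OF S(2,1)] by blast
    let ?B = "\<lambda>x. {y \<in> mspace (fst X). ?d x y < r/3}"
    have Bpos: "measure (snd X) (?B x) > 0" if "x \<in> S" for x
      using is_mmD(6)[OF X, of x "r/3"] that S r(1) by (auto simp: emeasure_eq_measure)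
    \<comment> \<open>Being at most every ball mass, \<open>e\<close> makes each ball meet the good
      set \<open>I0\<close>. Being at most \<open>r/3\<close>, the ball radius, it lets three steps
      of the triangle inequality stay below \<open>r\<close>, which gives injectivity.\<close>
    define e where "e = Min (insert (r/3) ((\<lambda>x. measure (snd X) (?B x)) ` S))"
    have fin: "finite (insert (r/3) ((\<lambda>x. measure (snd X) (?B x)) ` S))" using S by simp
    have "e > 0"
      unfolding e_def using r(1) Bpos by (subst Min_gr_iff[OF fin]) simp_all
    moreover have "e \<le> r/3" "\<And>x. x \<in> S \<Longrightarrow> e \<le> measure (snd X) (?B x)"
      unfolding e_def by (rule Min_le[OF fin], simp)+
    ultimately have e: "e > 0" "e \<le> r/3" "\<And>x. x \<in> S \<Longrightarrow> e \<le> measure (snd X) (?B x)"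
      by blast+
    obtain Y where Y: "Y \<in> gen K w D" "box X Y < e" using lim[OF e(1)] by blast
    then obtain F where Ym: "is_mm Y" and F: "fits K w Y F" unfolding gen_def by blast
    obtain eps phi psi I0 where eps: "0 \<le> eps" "eps < e" and phi: "parametrization X phi"
      and psi: "parametrization Y psi" and I0: "I0 \<in> sets L01" "measure L01 I0 \<ge> 1 - eps"
      and close: "\<And>s t. s \<in> I0 \<Longrightarrow> t \<in> I0 \<Longrightarrow>
         \<bar>?d (phi s) (phi t) - mdist (fst Y) (psi s) (psi t)\<bar> \<le> eps"
      using box_less_witness[OF X Ym Y(2)] by blast
    have "\<exists>s\<in>I0. phi s \<in> ?B x" if "x \<in> S" for x
    proof -
      have x: "x \<in> mspace (fst X)" using that S by blast
      have m: "measure (snd X) (?B x) > eps" using e(3)[OF that] eps by linarith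
      obtain t where "t \<in> I0" "phi t \<in> ?B x"
        by (rule parametrization_meets[OF phi ball_sets[OF X x] I0 m])
      then show ?thesis by blast
    qed
    then obtain s where s: "\<And>x. x \<in> S \<Longrightarrow> s x \<in> I0" "\<And>x. x \<in> S \<Longrightarrow> phi (s x) \<in> ?B x"
      by metis
    have psiY: "psi (s x) \<in> F ` K" if "x \<in> S" for x
      using parametrization_space[OF psi Ym I0(1) s(1)[OF that]] fits_surj[OF Ym F] by simp
    have "inj_on (psi \<circ> s) S"
    proof (rule inj_onI, rule ccontr)
      fix x y assume xy: "x \<in> S" "y \<in> S" "(psi \<circ> s) x = (psi \<circ> s) y" "x \<noteq> y"
      have "psi (s y) \<in> mspace (fst Y)" using psiY[OF xy(2)] fits_surj[OF Ym F] by simp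
      then have "mdist (fst Y) (psi (s x)) (psi (s y)) = 0" using xy(3) by simp
      then have 1: "?d (phi (s x)) (phi (s y)) \<le> eps"
        using close[OF s(1)[OF xy(1)] s(1)[OF xy(2)]] by simp
      have m: "x \<in> mspace (fst X)" "y \<in> mspace (fst X)" "phi (s x) \<in> mspace (fst X)" "phi (s y) \<in> mspace (fst X)"
        using s(2) xy S by auto
      have "?d x y \<le> ?d x (phi (s x)) + ?d (phi (s x)) (phi (s y)) + ?d y (phi (s y))"
        using M.triangle[OF m(1,3,2)] M.triangle'[OF m(3,4,2)] M.commute by smt
      also have "\<dots> < r/3 + r/3 + r/3"
        using 1 eps e(2) s(2)[OF xy(1)] s(2)[OF xy(2)] by simp
      finally show False using r(2)[OF xy(1,2,4)] by simp
    qed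
    then have "card S = card ((psi \<circ> s) ` S)" by (simp only: card_image)
    also have "\<dots> \<le> card (F ` K)" using psiY finite_K by (intro card_mono) auto
    also have "\<dots> \<le> card K" by (rule card_image_le[OF finite_K])
    finally show ?thesis .
  qed
  then show ?thesis using finite_if_finite_subsets_card_bdd[of "mspace (fst X)" "card K"] by blast
qed

text \<open>Every label has mass at least \<open>e\<close>, so some parameter in the good set is
  sent to \<open>F i\<close>; the point of \<open>X\<close> at that parameter becomes
  \<open>G i\<close>. Extensional functions are used to make the set of candidates finite, so that
  one of them can later serve all tolerances.\<close>

lemma approximate_fit:
  assumes X: "is_mm X" "finite (mspace (fst X))" and Y: "Y \<in> gen K w D" "box X Y < e"
    and sep: "\<And>x y. x \<in> mspace (fst X) \<Longrightarrow> y \<in> mspace (fst X) \<Longrightarrow> x \<noteq> y \<Longrightarrow> e \<le> mdist (fst X) x y"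
    and small: "\<And>i. i \<in> K \<Longrightarrow> e \<le> w i"
  shows "\<exists>G\<in>K \<rightarrow>\<^sub>E mspace (fst X).
     (\<forall>i\<in>K. \<forall>j\<in>K. ereal (mdist (fst X) (G i) (G j)) \<le> D i j + ereal e) \<and>
     (\<forall>A\<in>sets (snd X). \<bar>measure (snd X) A - (\<Sum>i\<in>{i\<in>K. G i \<in> A}. w i)\<bar> \<le> e)"
proof -
  obtain F where Ym: "is_mm Y" and F: "fits K w Y F"
      and FD: "\<And>i j. i \<in> K \<Longrightarrow> j \<in> K \<Longrightarrow> ereal (mdist (fst Y) (F i) (F j)) \<le> D i j"
    using Y(1) unfolding gen_def by blast
  obtain eps phi psi I0 where eps: "0 \<le> eps" "eps < e" and phi: "parametrization X phi"
    and psi: "parametrization Y psi" and I0: "I0 \<in> sets L01" "measure L01 I0 \<ge> 1 - eps"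
    and close: "\<And>s t. s \<in> I0 \<Longrightarrow> t \<in> I0 \<Longrightarrow>
       \<bar>mdist (fst X) (phi s) (phi t) - mdist (fst Y) (psi s) (psi t)\<bar> \<le> eps"
    using box_less_witness[OF X(1) Ym Y(2)] by blast
  have Fm: "F i \<in> mspace (fst Y)" if "i \<in> K" for i using F that by (auto simp: fits_def)
  have phiX: "phi s \<in> mspace (fst X)" if "s \<in> I0" for s
    by (rule parametrization_space[OF phi X(1) I0(1) that])
  have psiY: "psi s \<in> F ` K" if "s \<in> I0" for s
    using parametrization_space[OF psi Ym I0(1) that] fits_surj[OF Ym F] by simp
  have "\<exists>s\<in>I0. psi s = F i" if i: "i \<in> K" for i
  proof -
    have A: "{F i} \<in> sets (snd Y)" using fits_sets[OF Ym F] Fm[OF i] by simp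
    then have "measure (snd Y) {F i} = sum w {j\<in>K. F j \<in> {F i}}"
      using F unfolding fits_def by blast
    also have "\<dots> \<ge> w i"
      using finite_K pos i by (intro member_le_sum) (auto simp: less_imp_le)
    finally have "measure (snd Y) {F i} > eps" using small[OF i] eps by simp
    from parametrization_meets[OF psi A I0 this] show ?thesis by blast
  qed
  then obtain s where s: "\<And>i. i \<in> K \<Longrightarrow> s i \<in> I0" "\<And>i. i \<in> K \<Longrightarrow> psi (s i) = F i" by metis
  define G where "G = restrict (\<lambda>i. phi (s i)) K"
  \<comment> \<open>Distinct points of \<open>X\<close> are at least \<open>e\<close> apart, while
    the distortion on \<open>I0\<close> is below \<open>e\<close>; so within \<open>I0\<close> the
    map \<open>phi\<close> is constant on each fibre of \<open>psi\<close>.\<close>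
  have G: "phi t = G i" if "t \<in> I0" "i \<in> K" "psi t = F i" for t i
  proof (rule ccontr)
    assume "phi t \<noteq> G i"
    then have "e \<le> mdist (fst X) (phi t) (phi (s i))"
      using that s phiX by (intro sep) (auto simp: G_def)
    moreover have "mdist (fst Y) (psi t) (psi (s i)) = 0"
      using that s(2) Fm by simp
    ultimately show False using close[OF that(1) s(1)[OF that(2)]] eps by simp
  qed
  have "G \<in> K \<rightarrow>\<^sub>E mspace (fst X)" using s phiX by (auto simp: G_def)
  moreover have "ereal (mdist (fst X) (G i) (G j)) \<le> D i j + ereal e" if "i \<in> K" "j \<in> K" for i j
  proof -
    have "mdist (fst X) (G i) (G j) \<le> mdist (fst Y) (F i) (F j) + e"
      using close[OF s(1)[OF that(1)] s(1)[OF that(2)]] s(2) that eps by (simp add: G_def)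
    then have "ereal (mdist (fst X) (G i) (G j)) \<le> ereal (mdist (fst Y) (F i) (F j)) + ereal e" by simp
    also have "\<dots> \<le> D i j + ereal e" using FD[OF that] by (rule add_right_mono)
    finally show ?thesis .
  qed
  moreover have "\<bar>measure (snd X) A - (\<Sum>i\<in>{i\<in>K. G i \<in> A}. w i)\<bar> \<le> e" if A: "A \<in> sets (snd X)" for A
  proof -
    \<comment> \<open>\<open>B\<close> is the counterpart of \<open>A\<close> in \<open>Y\<close>:
      within \<open>I0\<close> the two have the same preimage, so their measures differ by at most
      \<open>eps\<close>, and the measure of \<open>B\<close> is exactly a sum of weights.\<close>
    define B where "B = F ` {i\<in>K. G i \<in> A}"
    have B: "B \<in> sets (snd Y)" using Fm fits_sets[OF Ym F] by (auto simp: B_def)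
    have FB: "F i \<in> B \<longleftrightarrow> G i \<in> A" if "i \<in> K" for i
    proof
      assume "F i \<in> B"
      then obtain j where "j \<in> K" "G j \<in> A" "F i = F j" by (auto simp: B_def)
      then show "G i \<in> A" using G[OF s(1)[OF that], of j] G[OF s(1)[OF that], of i] s(2) that by simp
    qed (use that in \<open>auto simp: B_def\<close>)
    have "measure (snd Y) B = (\<Sum>i\<in>{i\<in>K. F i \<in> B}. w i)" using F B by (auto simp: fits_def)
    also have "{i\<in>K. F i \<in> B} = {i\<in>K. G i \<in> A}" using FB by auto
    finally have mB: "measure (snd Y) B = (\<Sum>i\<in>{i\<in>K. G i \<in> A}. w i)" .
    have "phi t \<in> A \<longleftrightarrow> psi t \<in> B" if "t \<in> I0" for t
      using psiY[OF that] G[OF that] FB by auto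
    then have "(phi -` A \<inter> {0..<1}) \<inter> I0 = (psi -` B \<inter> {0..<1}) \<inter> I0" by blast
    then have "\<bar>measure L01 (phi -` A \<inter> {0..<1}) - measure L01 (psi -` B \<inter> {0..<1})\<bar> \<le> eps"
      using measure_parametrization[OF phi A] measure_parametrization[OF psi B] I0
      by (intro measure_close) auto
    then show ?thesis
      using measure_parametrization[OF phi A] measure_parametrization[OF psi B] mB eps by simp
  qed
  ultimately show ?thesis by blast
qed

end

text \<open>If each of the finitely many candidates failed at some tolerance, then by monotonicity
  all of them would fail at the smallest of these tolerances.\<close>

lemma finite_uniform_choice:
  fixes R :: "'a \<Rightarrow> real \<Rightarrow> bool"
  assumes "finite T" "e0 > 0" and ex: "\<And>e. 0 < e \<Longrightarrow> e \<le> e0 \<Longrightarrow> \<exists>G\<in>T. R G e"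
    and mono: "\<And>G e e'. R G e \<Longrightarrow> e \<le> e' \<Longrightarrow> R G e'"
  shows "\<exists>G\<in>T. \<forall>e>0. R G e"
proof (rule ccontr)
  assume "\<not> ?thesis"
  then obtain f where f: "\<And>G. G \<in> T \<Longrightarrow> f G > 0 \<and> \<not> R G (f G)" by metis
  let ?e = "Min (insert e0 (f ` T))"
  have "?e > 0" "?e \<le> e0" using f assms(1,2) by auto
  then obtain G where G: "G \<in> T" "R G ?e" using ex by blast
  moreover have "?e \<le> f G" using G assms(1) by (intro Min_le) auto
  ultimately show False using f mono by blast
qed

context weights
begin

text \<open>The map from \<open>approximate_fit\<close> depends on the tolerance, but a finite space
  admits only finitely many maps from \<open>K\<close>. One of them works for all tolerances, and
  letting these tend to 0 makes it an exact fit.\<close>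

lemma gen_box_closed:
  assumes X: "is_mm X" and lim: "\<And>e. e > 0 \<Longrightarrow> \<exists>Y\<in>gen K w D. box X Y < e"
  shows "X \<in> gen K w D"
proof -
  have fin: "finite (mspace (fst X))" by (rule finite_of_box_limit[OF assms])
  obtain r where r: "r > 0" "\<And>x y. x \<in> mspace (fst X) \<Longrightarrow> y \<in> mspace (fst X) \<Longrightarrow> x \<noteq> y \<Longrightarrow> r \<le> mdist (fst X) x y"
    using finite_separated[OF fin subset_refl] by blast
  define e0 where "e0 = Min (insert r (w ` K))"
  have e0: "e0 > 0" "e0 \<le> r" "\<And>i. i \<in> K \<Longrightarrow> e0 \<le> w i"
    using finite_K pos r(1) by (auto simp: e0_def)
  let ?R = "\<lambda>G e. (\<forall>i\<in>K. \<forall>j\<in>K. ereal (mdist (fst X) (G i) (G j)) \<le> D i j + ereal e) \<and>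
     (\<forall>A\<in>sets (snd X). \<bar>measure (snd X) A - (\<Sum>i\<in>{i\<in>K. G i \<in> A}. w i)\<bar> \<le> e)"
  have "\<exists>G\<in>K \<rightarrow>\<^sub>E mspace (fst X). \<forall>e>0. ?R G e"
  proof (rule finite_uniform_choice[OF _ e0(1)])
    show "finite (K \<rightarrow>\<^sub>E mspace (fst X))" using finite_K fin by (intro finite_PiE) auto
    show "\<exists>G\<in>K \<rightarrow>\<^sub>E mspace (fst X). ?R G e" if e: "0 < e" "e \<le> e0" for e
    proof -
      obtain Y where Y: "Y \<in> gen K w D" "box X Y < e" using lim[OF e(1)] by blast
      show ?thesis
        by (rule approximate_fit[OF X fin Y]) (use r(2) e e0 in fastforce)+
    qed
    show "?R G e'" if "?R G e" "e \<le> e'" for G e e'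
    proof -
      have "D i j + ereal e \<le> D i j + ereal e'" for i j using that(2) by (intro add_left_mono) simp
      with that show ?thesis by (meson order_trans)
    qed
  qed
  then obtain G where G: "G \<in> K \<rightarrow>\<^sub>E mspace (fst X)" "\<And>e. e > 0 \<Longrightarrow> ?R G e" by blast
  have "measure (snd X) A = (\<Sum>i\<in>{i\<in>K. G i \<in> A}. w i)" if "A \<in> sets (snd X)" for A
  proof -
    have "\<bar>measure (snd X) A - (\<Sum>i\<in>{i\<in>K. G i \<in> A}. w i)\<bar> \<le> 0"
      by (rule field_le_epsilon) (use G(2) that in simp)
    then show ?thesis by simp
  qed
  then have "fits K w X G" using G(1) by (auto simp: fits_def)
  moreover have "ereal (mdist (fst X) (G i) (G j)) \<le> D i j" if "i \<in> K" "j \<in> K" for i j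
    by (rule ereal_le_epsilon2) (use G(2) that in blast)
  ultimately show ?thesis using X unfolding gen_def by blast
qed

text \<open>Both spaces are labelled by the same \<open>K\<close>, so the maximum of the two
  pulled-back distances dominates both. Raising it to at least \<open>eps\<close> off the diagonal
  turns this pseudometric into a metric, and the lower bound on \<open>D\<close> keeps it
  admissible.\<close>

lemma gen_directed:
  assumes eps: "eps > 0" "\<And>i j. i \<in> K \<Longrightarrow> j \<in> K \<Longrightarrow> i \<noteq> j \<Longrightarrow> ereal eps \<le> D i j"
    and diag: "\<And>i. i \<in> K \<Longrightarrow> 0 \<le> D i i"
    and X: "X \<in> gen K w D" and Y: "Y \<in> gen K w D"
  shows "\<exists>Z\<in>gen K w D. dominated X Z \<and> dominated Y Z"
proof -
  obtain F where Xm: "is_mm X" and F: "fits K w X F"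
      "\<And>i j. i \<in> K \<Longrightarrow> j \<in> K \<Longrightarrow> ereal (mdist (fst X) (F i) (F j)) \<le> D i j"
    using X unfolding gen_def by blast
  obtain G where Ym: "is_mm Y" and G: "fits K w Y G"
      "\<And>i j. i \<in> K \<Longrightarrow> j \<in> K \<Longrightarrow> ereal (mdist (fst Y) (G i) (G j)) \<le> D i j"
    using Y unfolding gen_def by blast
  have Fm: "F i \<in> mspace (fst X)" and Gm: "G i \<in> mspace (fst Y)" if "i \<in> K" for i
    using F(1) G(1) that by (auto simp: fits_def)
  define d where "d i j = (if i = j then 0 else max eps (max (mdist (fst X) (F i) (F j)) (mdist (fst Y) (G i) (G j))))" for i j
  have d: "Metric_space K d"
  proof
    show "d i k \<le> d i j + d j k" if "i \<in> K" "j \<in> K" "k \<in> K" for i j k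
    proof (cases "i = j \<or> j = k \<or> i = k")
      case False
      then show ?thesis
        using mdist_triangle[OF Fm[OF that(1)] Fm[OF that(2)] Fm[OF that(3)]]
          mdist_triangle[OF Gm[OF that(1)] Gm[OF that(2)] Gm[OF that(3)]] eps(1)
        unfolding d_def by auto
    qed (use eps(1) in \<open>auto simp: d_def\<close>)
  qed (use eps(1) in \<open>auto simp: d_def mdist_commute\<close>)
  have le: "mdist (fst X) (F i) (F j) \<le> d i j" "mdist (fst Y) (G i) (G j) \<le> d i j" if "i \<in> K" "j \<in> K" for i j
    using mdist_zero[OF Fm[OF that(1)] Fm[OF that(1)]] mdist_zero[OF Gm[OF that(1)] Gm[OF that(1)]]
    by (auto simp: d_def)
  have "ereal (d i j) \<le> D i j" if "i \<in> K" "j \<in> K" for i j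
    using F(2)[OF that] G(2)[OF that] eps(2)[OF that] diag[OF that(1)] by (auto simp: d_def max_def simp flip: zero_ereal_def)
  then have "finite_mm K w d \<in> gen K w D"
    unfolding gen_def using is_mm_finite_mm[OF d] fits_finite_mm[OF d] mdist_finite_mm[OF d] by auto
  then show ?thesis
    using dominated_finite_mm[OF d Xm F(1)] dominated_finite_mm[OF d Ym G(1)] le by blast
qed

lemma finite_mm_in_gen:
  assumes d: "Metric_space K d" and "\<And>i j. i \<in> K \<Longrightarrow> j \<in> K \<Longrightarrow> ereal (d i j) \<le> D i j"
  shows "finite_mm K w d \<in> gen K w D"
  unfolding gen_def using is_mm_finite_mm[OF d] fits_finite_mm[OF d] mdist_finite_mm[OF d] assms(2) by auto

lemma pyramid_gen:
  assumes eps: "eps > 0" "\<And>i j. i \<in> K \<Longrightarrow> j \<in> K \<Longrightarrow> i \<noteq> j \<Longrightarrow> ereal eps \<le> D i j"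
    and diag: "\<And>i. i \<in> K \<Longrightarrow> 0 \<le> D i i"
  shows "pyramid (gen K w D)"
proof -
  have "finite_mm K w (\<lambda>i j. if i = j then 0 else eps) \<in> gen K w D"
    using eps diag by (intro finite_mm_in_gen) (unfold_locales, auto simp flip: zero_ereal_def)
  moreover have "\<forall>X\<in>gen K w D. is_mm X" by (simp add: gen_def)
  ultimately show ?thesis
    unfolding pyramid_def
    using gen_box_closed[of _ D] gen_dominated[of _ D] gen_directed[where D=D, OF eps diag] by blast
qed

end

section \<open>Weak convergence and uniqueness of topological limits\<close>

lemma box_set_mem:
  assumes P: "\<And>X. X \<in> P \<Longrightarrow> is_mm X" and X: "X \<in> P"
  shows "box_set X P = 0"
proof -
  have nonneg: "0 \<le> box X Y" if "Y \<in> P" for Y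
    using box_nonneg P X that by blast
  have "box_set X P \<le> box X X"
    unfolding box_set_def using nonneg X by (intro cInf_lower bdd_belowI[of _ 0]) auto
  moreover have "0 \<le> box_set X P"
    unfolding box_set_def using nonneg X by (intro cInf_greatest) auto
  ultimately show ?thesis using box_self P X by simp
qed

text \<open>For monotone sequences no box distance has to be computed: membership gives distance 0,
  and a pyramid \<open>Q\<close> that contains a tail and misses \<open>X\<close> keeps a positive
  distance from \<open>X\<close>, being box-closed.\<close>

lemma weak_convI:
  assumes pyr: "\<And>n. pyramid (Ps n)"
    and "in": "\<And>X. X \<in> P \<Longrightarrow> eventually (\<lambda>n. X \<in> Ps n) sequentially"
    and out: "\<And>X. is_mm X \<Longrightarrow> X \<notin> P \<Longrightarrow>
        \<exists>Q. pyramid Q \<and> X \<notin> Q \<and> eventually (\<lambda>n. Ps n \<subseteq> Q) sequentially"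
  shows "weak_conv Ps P"
  unfolding weak_conv_def
proof (intro conjI ballI allI impI)
  fix X assume "X \<in> P"
  have "box_set X (Ps n) = 0" if "X \<in> Ps n" for n
    using pyr[of n] that by (intro box_set_mem) (simp_all add: pyramid_def)
  then have "eventually (\<lambda>n. box_set X (Ps n) = 0) sequentially"
    by (rule eventually_mono[OF "in"[OF \<open>X \<in> P\<close>]])
  then show "(\<lambda>n. box_set X (Ps n)) \<longlonglongrightarrow> 0" by (rule tendsto_eventually)
next
  fix X assume X: "is_mm X \<and> X \<notin> P"
  then obtain Q where Q: "pyramid Q" "X \<notin> Q" and sub: "eventually (\<lambda>n. Ps n \<subseteq> Q) sequentially"
    using out by blast
  then obtain e where e: "e > 0" "\<And>Y. Y \<in> Q \<Longrightarrow> e \<le> box X Y"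
    using X unfolding pyramid_def by (meson not_less)
  have "eventually (\<lambda>n. ereal e \<le> ereal (box_set X (Ps n))) sequentially"
    using sub
  proof eventually_elim
    case (elim n)
    moreover have "Ps n \<noteq> {}" using pyr unfolding pyramid_def by blast
    ultimately show ?case
      unfolding box_set_def ereal_less_eq using e(2) by (intro cInf_greatest) auto
  qed
  then have "ereal e \<le> liminf (\<lambda>n. ereal (box_set X (Ps n)))" by (rule Liminf_bounded)
  then show "liminf (\<lambda>n. ereal (box_set X (Ps n))) > 0"
    using e(1) by (metis ereal_less(2) less_le_trans)
qed

lemma weak_conv_const:
  assumes "pyramid P"
  shows "weak_conv (\<lambda>_. P) P"
  by (rule weak_convI) (use assms in auto)

lemma weak_conv_subseq:
  assumes "weak_conv Ps P" "strict_mono r"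
  shows "weak_conv (\<lambda>n. Ps (r n)) P"
  unfolding weak_conv_def
proof (intro conjI ballI allI impI)
  fix X assume "X \<in> P"
  then show "(\<lambda>n. box_set X (Ps (r n))) \<longlonglongrightarrow> 0"
    using LIMSEQ_subseq_LIMSEQ[OF _ assms(2)] assms(1) unfolding weak_conv_def comp_def by blast
next
  fix X assume X: "is_mm X \<and> X \<notin> P"
  have "liminf (\<lambda>n. ereal (box_set X (Ps n))) \<le> liminf ((\<lambda>n. ereal (box_set X (Ps n))) \<circ> r)"
    by (rule liminf_subseq_mono[OF assms(2)])
  with X assms(1) show "liminf (\<lambda>n. ereal (box_set X (Ps (r n)))) > 0"
    unfolding weak_conv_def comp_def by (metis less_le_trans)
qed

text \<open>At a space in \<open>P\<close> but not in \<open>P'\<close> the box distances would tend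
  to 0 and yet have a positive liminf.\<close>

lemma weak_conv_subset:
  assumes P: "pyramid P" and conv: "weak_conv Ps P" "weak_conv Ps P'"
  shows "P \<subseteq> P'"
proof (rule subsetI, rule ccontr)
  fix X assume X: "X \<in> P" "X \<notin> P'"
  then have "is_mm X" using P unfolding pyramid_def by blast
  then have "liminf (\<lambda>n. ereal (box_set X (Ps n))) > 0"
    using conv(2) X unfolding weak_conv_def by blast
  moreover have "(\<lambda>n. ereal (box_set X (Ps n))) \<longlonglongrightarrow> ereal 0"
    using conv(1) X unfolding weak_conv_def by (intro tendsto_intros) blast
  then have "liminf (\<lambda>n. ereal (box_set X (Ps n))) = 0"
    using lim_imp_Liminf[OF sequentially_bot] by (metis zero_ereal_def)
  ultimately show False by simp
qed

lemma weak_conv_unique: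
  assumes "pyramid P" "pyramid P'" "weak_conv Ps P" "weak_conv Ps P'"
  shows "P = P'"
  using weak_conv_subset assms by blast

section \<open>Limits in the sequential topology of weak convergence\<close>

lemma openin_weak_topology: "openin weak_topology = weak_open"
  unfolding weak_topology_def by (rule topology_inverse'[OF istopology_weak_open])

lemma topspace_weak_topology: "topspace weak_topology = Pyramids"
proof -
  have "weak_open Pyramids" unfolding weak_open_def by simp
  then show ?thesis
    unfolding topspace_def openin_weak_topology using weak_open_def by blast
qed

lemma limitin_of_weak_conv:
  assumes "\<And>n. Ps n \<in> Pyramids" "P \<in> Pyramids" "weak_conv Ps P"
  shows "limitin weak_topology Ps P sequentially"
  using assms unfolding limitin_def topspace_weak_topology openin_weak_topology weak_open_def by blast

text \<open>Either some value recurs infinitely often, or all sublevel sets are finite and larger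
  values can always be found further on.\<close>

lemma subsequence_or_constant:
  fixes k :: "nat \<Rightarrow> nat"
  shows "\<exists>r::nat \<Rightarrow> nat. strict_mono r \<and> ((\<exists>m. \<forall>n. k (r n) = m) \<or> strict_mono (k \<circ> r))"
proof (cases "\<exists>m. infinite {n. k n = m}")
  case True
  then obtain m where "infinite {n. k n = m}" by blast
  from infinite_enumerate[OF this] obtain r :: "nat \<Rightarrow> nat"
    where "strict_mono r" "\<forall>n. k (r n) = m" by auto
  then show ?thesis by blast
next
  case False
  have fin: "finite {n. k n \<le> m}" for m
  proof -
    have "{n. k n \<le> m} = (\<Union>i\<le>m. {n. k n = i})" by auto
    then show ?thesis using False by simp
  qed
  have step: "\<exists>y. x < y \<and> k x < k y" for x
  proof -
    have "finite ({n. k n \<le> k x} \<union> {..x})" using fin by simp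
    then obtain y where "y \<notin> {n. k n \<le> k x} \<union> {..x}"
      using ex_new_if_finite infinite_UNIV_nat by blast
    then show ?thesis by (auto simp: not_le)
  qed
  from dependent_nat_choice[of "\<lambda>_ _. True" "\<lambda>_ x y. x < y \<and> k x < k y"] step
  obtain r where "\<forall>n. r n < r (Suc n) \<and> k (r n) < k (r (Suc n))" by blast
  then show ?thesis by (intro exI[of _ r]) (simp add: strict_mono_Suc_iff)
qed

lemma subseq_of_not_eventually:
  assumes "\<not> (\<forall>\<^sub>F n in sequentially. P n)"
  shows "\<exists>r::nat \<Rightarrow> nat. strict_mono r \<and> (\<forall>n. \<not> P (r n))"
proof -
  have "infinite {n. \<not> P n}"
    using assms unfolding cofinite_eq_sequentially[symmetric] eventually_cofinite .
  from infinite_enumerate[OF this] show ?thesis by simp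
qed

text \<open>The terms of \<open>ys\<close> may come from \<open>xs\<close> in any order and with
  repetitions. Along a subsequence their indices are constant, and then the limit is a term of
  \<open>xs\<close>, or strictly increasing, and then it is the limit of a subsequence of
  \<open>xs\<close>.\<close>

lemma limit_of_range:
  fixes xs :: "nat \<Rightarrow> mm set"
  assumes xs: "\<And>n. xs n \<in> Pyramids" and ys: "\<And>n. ys n \<in> range xs"
    and y: "y \<in> Pyramids" "weak_conv ys y"
  shows "y \<in> range xs \<or> (\<exists>r. strict_mono r \<and> weak_conv (\<lambda>n. xs (r n)) y)"
proof -
  have "\<forall>n. \<exists>k. ys n = xs k" using ys by (simp add: image_iff)
  then obtain k where k: "\<And>n. ys n = xs (k n)" by (auto dest: choice)
  obtain r :: "nat \<Rightarrow> nat" where r: "strict_mono r" and alt: "(\<exists>m. \<forall>n. k (r n) = m) \<or> strict_mono (k \<circ> r)"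
    using subsequence_or_constant[of k] by auto
  have conv: "weak_conv (\<lambda>n. xs (k (r n))) y"
    using weak_conv_subseq[OF y(2) r] k by simp
  from alt show ?thesis
  proof
    assume "\<exists>m. \<forall>n. k (r n) = m"
    then obtain m where "\<forall>n. k (r n) = m" ..
    then have "y = xs m"
      using weak_conv_unique[OF _ _ conv] weak_conv_const xs y(1) by (simp add: Pyramids_def)
    then show ?thesis by simp
  next
    assume "strict_mono (k \<circ> r)"
    with conv show ?thesis by (auto simp: comp_def)
  qed
qed

text \<open>This supplies the open sets that separate limits. A weakly convergent sequence that is
  in the range infinitely often has a subsequence there, and \<open>limit_of_range\<close> puts its
  limit into the range as well.\<close>

lemma weak_open_compl_range:
  fixes xs :: "nat \<Rightarrow> mm set"
  assumes xs: "\<And>n. xs n \<in> Pyramids"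
    and sub: "\<And>r y. strict_mono r \<Longrightarrow> y \<in> Pyramids \<Longrightarrow> weak_conv (\<lambda>n. xs (r n)) y \<Longrightarrow> y \<in> range xs"
  shows "weak_open (Pyramids - range xs)"
  unfolding weak_open_def
proof (intro conjI ballI allI impI)
  fix P Ps assume P: "P \<in> Pyramids - range xs" and Ps: "(\<forall>n. Ps n \<in> Pyramids) \<and> weak_conv Ps P"
  show "\<forall>\<^sub>F n in sequentially. Ps n \<in> Pyramids - range xs"
  proof (rule ccontr)
    assume "\<not> ?thesis"
    from subseq_of_not_eventually[OF this] obtain r :: "nat \<Rightarrow> nat"
      where r: "strict_mono r" "\<forall>n. Ps (r n) \<notin> Pyramids - range xs"
      by auto
    then have rng: "Ps (r n) \<in> range xs" for n using Ps by (simp add: Diff_iff)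
    then have "weak_conv (\<lambda>n. Ps (r n)) P" using weak_conv_subseq[OF conjunct2[OF Ps] r(1)] by simp
    from limit_of_range[OF xs rng _ this] show False using P sub by blast
  qed
qed auto

lemma weak_conv_tail:
  assumes "weak_conv Ps P" "\<And>n. Qs (n + k) = Ps (n + l)"
  shows "weak_conv Qs P"
proof -
  have "(\<lambda>n. box_set X (Qs n)) \<longlonglongrightarrow> 0" if "(\<lambda>n. box_set X (Ps n)) \<longlonglongrightarrow> 0" for X
  proof (rule LIMSEQ_offset[of _ k])
    show "(\<lambda>n. box_set X (Qs (n + k))) \<longlonglongrightarrow> 0"
      unfolding assms(2) by (rule LIMSEQ_ignore_initial_segment[OF that])
  qed
  moreover have "liminf (\<lambda>n. ereal (box_set X (Qs n))) = liminf (\<lambda>n. ereal (box_set X (Ps n)))" for X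
    using liminf_shift_k[of "\<lambda>n. ereal (box_set X (Qs n))" k]
      liminf_shift_k[of "\<lambda>n. ereal (box_set X (Ps n))" l] assms(2) by simp
  ultimately show ?thesis using assms(1) unfolding weak_conv_def by simp
qed

lemma frequently_eq_subseq_limit:
  fixes xs :: "nat \<Rightarrow> mm set"
  assumes xs: "\<And>n. xs n \<in> Pyramids" and freq: "\<not> (\<forall>\<^sub>F n in sequentially. xs n \<noteq> x)"
  shows "\<exists>r. strict_mono r \<and> weak_conv (\<lambda>n. xs (r n)) x"
proof -
  from subseq_of_not_eventually[OF freq] obtain r :: "nat \<Rightarrow> nat"
    where r: "strict_mono r" "\<forall>n. xs (r n) = x" by auto
  then have "(\<lambda>n. xs (r n)) = (\<lambda>_. x)" by simp
  moreover have "pyramid x" using xs[of "r 0"] r(2) by (simp add: Pyramids_def)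
  ultimately show ?thesis using weak_conv_const r(1) by metis
qed

text \<open>As in Kisynski's theorem on sequential spaces: if \<open>x \<noteq> y\<close>, a tail of the sequence together with \<open>y\<close> is
sequentially closed and avoids \<open>x\<close>.\<close>

lemma topological_limit_eq_weak_limit:
  assumes xs: "\<And>n. xs n \<in> Pyramids" and top: "limitin weak_topology xs x sequentially"
    and y: "y \<in> Pyramids" "weak_conv xs y"
  shows "x = y"
proof (rule ccontr)
  assume "x \<noteq> y"
  have x: "x \<in> Pyramids" using limitin_topspace[OF top] by (simp add: topspace_weak_topology)
  have "\<forall>\<^sub>F n in sequentially. xs n \<noteq> x"
  proof (rule ccontr)
    assume "\<not> ?thesis"
    then obtain r where "strict_mono r" "weak_conv (\<lambda>n. xs (r n)) x"
      using frequently_eq_subseq_limit[of xs, OF xs] by blast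
    then have r: "strict_mono r" "weak_conv (\<lambda>n. xs (r n)) x" by simp_all
    have "x = y"
      using weak_conv_unique[OF _ _ r(2) weak_conv_subseq[OF y(2) r(1)]] x y(1)
      by (simp add: Pyramids_def)
    with \<open>x \<noteq> y\<close> show False by simp
  qed
  then obtain N where N: "\<And>n. n \<ge> N \<Longrightarrow> xs n \<noteq> x" unfolding eventually_sequentially by blast
  \<comment> \<open>The weak limit \<open>y\<close> sits at index 0, so the range contains every
    subsequential limit; dropping the first \<open>N\<close> terms keeps \<open>x\<close> out of
    it.\<close>
  define zs where "zs = case_nat y (\<lambda>n. xs (n + N))"
  have zs: "zs n \<in> Pyramids" for n using xs y(1) by (simp add: zs_def split: nat.split)
  have "weak_conv zs y" by (rule weak_conv_tail[OF y(2), of _ 1 N]) (simp add: zs_def)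
  then have "weak_open (Pyramids - range zs)"
  proof (intro weak_open_compl_range zs)
    fix r z assume r: "strict_mono r" "z \<in> Pyramids" "weak_conv (\<lambda>n. zs (r n)) z"
    have "z = y"
      using weak_conv_unique[OF _ _ r(3) weak_conv_subseq[OF \<open>weak_conv zs y\<close> r(1)]] r(2) y(1)
      by (simp add: Pyramids_def)
    then show "z \<in> range zs" by (auto simp: zs_def intro!: image_eqI[of _ _ 0])
  qed
  moreover have "x \<in> Pyramids - range zs"
  proof -
    have "x \<noteq> zs n" for n
    proof (cases n)
      case (Suc m)
      then show ?thesis using N[of "m + N"] by (simp add: zs_def)
    qed (use \<open>x \<noteq> y\<close> in \<open>simp add: zs_def\<close>)
    with x show ?thesis by blast
  qed
  ultimately have "\<forall>\<^sub>F n in sequentially. xs n \<in> Pyramids - range zs"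
    using top unfolding limitin_def openin_weak_topology by blast
  then obtain M where "\<And>n. n \<ge> M \<Longrightarrow> xs n \<notin> range zs" unfolding eventually_sequentially by blast
  moreover have "xs (M + N) = zs (Suc M)" by (simp add: zs_def)
  ultimately show False by (metis le_add1 rangeI)
qed

lemma limitin_weak_subseq:
  assumes "limitin weak_topology xs x sequentially" "strict_mono r"
  shows "limitin weak_topology (\<lambda>n. xs (r n)) x sequentially"
  using limitin_subsequence[OF assms(2,1)] by (simp add: comp_def)

text \<open>Otherwise no subsequence converges weakly at all, so a tail of the sequence is sequentially closed.\<close>

lemma topological_limit_has_weak_subseq:
  fixes xs :: "nat \<Rightarrow> mm set"
  assumes xs: "\<And>n. xs n \<in> Pyramids" and top: "limitin weak_topology xs x sequentially"
  shows "\<exists>r. strict_mono r \<and> weak_conv (\<lambda>n. xs (r n)) x"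
proof (rule ccontr)
  assume neg: "\<not> ?thesis"
  have x: "x \<in> Pyramids" using limitin_topspace[OF top] by (simp add: topspace_weak_topology)
  \<comment> \<open>By \<open>topological_limit_eq_weak_limit\<close>, a weak limit of a subsequence
    would have to be \<open>x\<close>, which \<open>neg\<close> excludes.\<close>
  have none: "\<not> weak_conv (\<lambda>n. xs (r n)) y" if "strict_mono r" "y \<in> Pyramids" for r y
    using topological_limit_eq_weak_limit[of "\<lambda>n. xs (r n)" x y, OF xs limitin_weak_subseq[OF top that(1)] that(2)]
      that neg by blast
  obtain N where N: "\<And>n. n \<ge> N \<Longrightarrow> xs n \<noteq> x"
    using frequently_eq_subseq_limit[of xs x, OF xs] neg unfolding eventually_sequentially by blast
  have "weak_open (Pyramids - range (\<lambda>n. xs (n + N)))"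
  proof (rule weak_open_compl_range)
    fix r y assume r: "strict_mono r" "y \<in> Pyramids" "weak_conv (\<lambda>n. xs (r n + N)) y"
    have "strict_mono (\<lambda>n. r n + N)" using r(1) by (simp add: strict_mono_def)
    from none[OF this r(2)] r(3) show "y \<in> range (\<lambda>n. xs (n + N))" by blast
  qed (rule xs)
  moreover have "x \<noteq> xs (n + N)" for n using N[of "n + N"] by simp
  then have "x \<in> Pyramids - range (\<lambda>n. xs (n + N))" using x by blast
  ultimately have "\<forall>\<^sub>F n in sequentially. xs n \<in> Pyramids - range (\<lambda>n. xs (n + N))"
    using top unfolding limitin_def openin_weak_topology by blast
  then obtain M where "\<And>n. n \<ge> M \<Longrightarrow> xs n \<notin> range (\<lambda>n. xs (n + N))"
    unfolding eventually_sequentially by blast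
  then show False by (metis le_add1 rangeI)
qed

text \<open>Some subsequence converges weakly to \<open>y\<close> and still converges topologically
  to \<open>x\<close>, so \<open>topological_limit_eq_weak_limit\<close> identifies the two.\<close>

lemma topological_limit_unique:
  assumes xs: "\<And>n. xs n \<in> Pyramids"
    and lim: "limitin weak_topology xs x sequentially" "limitin weak_topology xs y sequentially"
  shows "x = y"
proof -
  obtain r where r: "strict_mono r" "weak_conv (\<lambda>n. xs (r n)) y"
    using topological_limit_has_weak_subseq[of xs y, OF xs lim(2)] by blast
  have "y \<in> Pyramids" using limitin_topspace[OF lim(2)] by (simp add: topspace_weak_topology)
  then show ?thesis
    using topological_limit_eq_weak_limit[of "\<lambda>n. xs (r n)" x y, OF xs limitin_weak_subseq[OF lim(1) r(1)] _ r(2)]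
    by blast
qed

section \<open>Scaling\<close>

lemma Metric_space_scale:
  assumes "t > 0"
  shows "Metric_space (mspace m) (\<lambda>x y. t * mdist m x y)"
proof
  fix x y z assume "x \<in> mspace m" "y \<in> mspace m" "z \<in> mspace m"
  from mdist_triangle[OF this] assms show "t * mdist m x z \<le> t * mdist m x y + t * mdist m y z"
    by (simp flip: distrib_left)
qed (use assms in \<open>auto simp: mdist_commute\<close>)

context
  fixes t :: real and X :: mm
  assumes t: "t > 0"
begin

lemma mspace_scale_mm: "mspace (fst (scale_mm t X)) = mspace (fst X)"
  and mdist_scale_mm: "mdist (fst (scale_mm t X)) = (\<lambda>x y. t * mdist (fst X) x y)"
  and snd_scale_mm: "snd (scale_mm t X) = snd X"
  using Metric_space_scale[OF t, of "fst X"]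
  by (simp_all add: scale_mm_def Metric_space.mspace_metric Metric_space.mdist_metric)

lemma mtopology_scale_mm: "mtopology_of (fst (scale_mm t X)) = mtopology_of (fst X)"
  unfolding topology_eq openin_mtopology_of mspace_scale_mm mdist_scale_mm
proof (intro allI arg_cong2[of _ _ _ _ "(\<and>)"] refl ball_cong iffI)
  fix U :: "real set" and x
  assume "\<exists>r>0. \<forall>y\<in>mspace (fst X). t * mdist (fst X) x y < r \<longrightarrow> y \<in> U"
  then obtain r where "r > 0" "\<forall>y\<in>mspace (fst X). t * mdist (fst X) x y < r \<longrightarrow> y \<in> U" by blast
  then show "\<exists>r>0. \<forall>y\<in>mspace (fst X). mdist (fst X) x y < r \<longrightarrow> y \<in> U"
    using t by (intro exI[of _ "r / t"]) (simp add: field_simps)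
next
  fix U :: "real set" and x
  assume "\<exists>r>0. \<forall>y\<in>mspace (fst X). mdist (fst X) x y < r \<longrightarrow> y \<in> U"
  then obtain r where "r > 0" "\<forall>y\<in>mspace (fst X). mdist (fst X) x y < r \<longrightarrow> y \<in> U" by blast
  then show "\<exists>r>0. \<forall>y\<in>mspace (fst X). t * mdist (fst X) x y < r \<longrightarrow> y \<in> U"
    using t by (intro exI[of _ "t * r"]) simp
qed

lemma mcomplete_scale_mm:
  assumes "mcomplete_of (fst X)"
  shows "mcomplete_of (fst (scale_mm t X))"
proof -
  interpret M: Metric_space "mspace (fst X)" "mdist (fst X)" by simp
  interpret S: Metric_space "mspace (fst X)" "\<lambda>x y. t * mdist (fst X) x y"
    by (rule Metric_space_scale[OF t])
  have top: "S.mtopology = M.mtopology"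
    using mtopology_scale_mm unfolding mtopology_of_def mspace_scale_mm mdist_scale_mm .
  have "M.MCauchy \<sigma>" if Cauchy: "S.MCauchy \<sigma>" for \<sigma>
    unfolding M.MCauchy_def
  proof (intro conjI allI impI)
    show "range \<sigma> \<subseteq> mspace (fst X)" using that by (simp add: S.MCauchy_def)
    fix e :: real assume "e > 0"
    then have "t * e > 0" using t by simp
    then obtain N where "\<forall>n n'. N \<le> n \<longrightarrow> N \<le> n' \<longrightarrow> t * mdist (fst X) (\<sigma> n) (\<sigma> n') < t * e"
      using Cauchy unfolding S.MCauchy_def by blast
    then show "\<exists>N. \<forall>n n'. N \<le> n \<longrightarrow> N \<le> n' \<longrightarrow> mdist (fst X) (\<sigma> n) (\<sigma> n') < e"
      using t by auto
  qed
  then have "S.mcomplete"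
    using assms unfolding mcomplete_of_def M.mcomplete_def S.mcomplete_def top by blast
  then show ?thesis unfolding mcomplete_of_def mspace_scale_mm mdist_scale_mm .
qed

lemma is_mm_scale_mm:
  assumes X: "is_mm X"
  shows "is_mm (scale_mm t X)"
proof -
  have "emeasure (snd X) {y \<in> mspace (fst X). t * mdist (fst X) x y < r} > 0"
    if "x \<in> mspace (fst X)" "r > 0" for x r
  proof -
    have "{y \<in> mspace (fst X). t * mdist (fst X) x y < r} = {y \<in> mspace (fst X). mdist (fst X) x y < r / t}"
      using t by (auto simp: field_simps)
    with is_mmD(6)[OF X that(1), of "r / t"] t that show ?thesis by simp
  qed
  moreover have "sets (snd X) = borel_sets_of (fst (scale_mm t X))"
    using is_mmD(5)[OF X] unfolding borel_sets_of_def mspace_scale_mm mtopology_scale_mm .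
  ultimately show ?thesis
    using is_mmD[OF X] mcomplete_scale_mm
    unfolding is_mm_def Let_def by (simp add: mspace_scale_mm mdist_scale_mm snd_scale_mm mtopology_scale_mm)
qed

lemma scale_mm_scale_mm: "scale_mm s (scale_mm t X) = scale_mm (s * t) X"
  unfolding scale_mm_def[of s] mspace_scale_mm mdist_scale_mm snd_scale_mm
  by (simp add: scale_mm_def mult.assoc)

lemma fits_scale_mm: "fits K w (scale_mm t X) F \<longleftrightarrow> fits K w X F"
  by (simp add: fits_def mspace_scale_mm snd_scale_mm)

end

lemma scale_mm_one: "scale_mm 1 X = X"
  by (simp add: scale_mm_def mspace_def mdist_def dest_metric_inverse)

lemma scale_pyr_scale_pyr: "t > 0 \<Longrightarrow> scale_pyr s (scale_pyr t P) = scale_pyr (s * t) P"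
  by (simp add: scale_pyr_def image_image scale_mm_scale_mm)

lemma scale_pyr_one: "scale_pyr 1 P = P"
  by (simp add: scale_pyr_def scale_mm_one)

lemma self_in_orbit: "P \<in> orbit P"
  unfolding orbit_def using scale_pyr_one[of P] by (intro CollectI exI[of _ 1]) simp

lemma orbit_scale_pyr:
  assumes t: "t > 0"
  shows "orbit (scale_pyr t P) = orbit P"
proof (rule set_eqI, rule iffI)
  fix R assume "R \<in> orbit (scale_pyr t P)"
  then obtain s where "s > 0" "R = scale_pyr s (scale_pyr t P)" unfolding orbit_def by blast
  with t show "R \<in> orbit P"
    unfolding orbit_def by (intro CollectI exI[of _ "s * t"]) (simp add: scale_pyr_scale_pyr)
next
  fix R assume "R \<in> orbit P"
  then obtain s where "s > 0" "R = scale_pyr s P" unfolding orbit_def by blast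
  with t show "R \<in> orbit (scale_pyr t P)"
    unfolding orbit_def by (intro CollectI exI[of _ "s / t"]) (simp add: scale_pyr_scale_pyr)
qed

lemma genE:
  assumes "X \<in> gen K w D"
  obtains F where "is_mm X" "fits K w X F"
    "\<forall>i\<in>K. \<forall>j\<in>K. ereal (mdist (fst X) (F i) (F j)) \<le> D i j"
  using assms unfolding gen_def by blast

lemma genI:
  assumes "is_mm X" "fits K w X F"
    and "\<And>i j. i \<in> K \<Longrightarrow> j \<in> K \<Longrightarrow> ereal (mdist (fst X) (F i) (F j)) \<le> D i j"
  shows "X \<in> gen K w D"
  using assms unfolding gen_def by blast

lemma gen_scale_mm:
  assumes "X \<in> gen K w D" "t > 0"
  shows "scale_mm t X \<in> gen K w (\<lambda>i j. ereal t * D i j)"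
proof -
  obtain F where F: "is_mm X" "fits K w X F"
      "\<forall>i\<in>K. \<forall>j\<in>K. ereal (mdist (fst X) (F i) (F j)) \<le> D i j"
    using assms(1) by (rule genE)
  have "ereal (t * mdist (fst X) (F i) (F j)) \<le> ereal t * D i j" if "i \<in> K" "j \<in> K" for i j
    using ereal_mult_left_mono[OF F(3)[rule_format, OF that], of "ereal t"] assms(2) by simp
  then show ?thesis
    unfolding gen_def using F(1,2) is_mm_scale_mm[OF assms(2)]
    by (auto simp: fits_scale_mm[OF assms(2)] mdist_scale_mm[OF assms(2)])
qed

text \<open>Scaling leaves labels and masses alone and multiplies only the bounds; the reverse
  inclusion scales back by \<open>1 / t\<close>.\<close>

lemma scale_pyr_gen:
  assumes t: "t > 0"
  shows "scale_pyr t (gen K w D) = gen K w (\<lambda>i j. ereal t * D i j)"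
proof
  show "scale_pyr t (gen K w D) \<subseteq> gen K w (\<lambda>i j. ereal t * D i j)"
    unfolding scale_pyr_def using gen_scale_mm[OF _ t] by blast
  show "gen K w (\<lambda>i j. ereal t * D i j) \<subseteq> scale_pyr t (gen K w D)"
  proof
    fix X assume "X \<in> gen K w (\<lambda>i j. ereal t * D i j)"
    from gen_scale_mm[OF this, of "1 / t"] t
    have "scale_mm (1 / t) X \<in> gen K w D" by (simp flip: mult.assoc one_ereal_def)
    moreover have "X = scale_mm t (scale_mm (1 / t) X)"
      using t by (simp add: scale_mm_scale_mm scale_mm_one)
    ultimately show "X \<in> scale_pyr t (gen K w D)" unfolding scale_pyr_def by blast
  qed
qed

lemma gen_mono:
  assumes "X \<in> gen K w D" "\<And>i j. i \<in> K \<Longrightarrow> j \<in> K \<Longrightarrow> D i j \<le> D' i j"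
  shows "X \<in> gen K w D'"
proof -
  obtain F where F: "is_mm X" "fits K w X F"
      "\<forall>i\<in>K. \<forall>j\<in>K. ereal (mdist (fst X) (F i) (F j)) \<le> D i j"
    using assms(1) by (rule genE)
  have "ereal (mdist (fst X) (F i) (F j)) \<le> D' i j" if "i \<in> K" "j \<in> K" for i j
    using F(3)[rule_format, OF that] assms(2)[OF that] by (rule order_trans)
  with F(1,2) show ?thesis unfolding gen_def by blast
qed

section \<open>Equilateral test spaces\<close>

definition equilateral :: "real set \<Rightarrow> (real \<Rightarrow> real) \<Rightarrow> real \<Rightarrow> mm" where
  "equilateral K w c = finite_mm K w (\<lambda>i j. if i = j then 0 else c)"

context weights
begin

lemma Metric_space_equilateral: "c > 0 \<Longrightarrow> Metric_space K (\<lambda>i j. if i = j then 0 else c)"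
  by unfold_locales auto

lemma equilateral_in_gen:
  assumes "c > 0" "\<And>i. i \<in> K \<Longrightarrow> 0 \<le> D i i"
    and "\<And>i j. i \<in> K \<Longrightarrow> j \<in> K \<Longrightarrow> i \<noteq> j \<Longrightarrow> ereal c \<le> D i j"
  shows "equilateral K w c \<in> gen K w D"
  unfolding equilateral_def
  by (rule finite_mm_in_gen[OF Metric_space_equilateral[OF assms(1)]])
    (use assms in \<open>auto simp flip: zero_ereal_def\<close>)

text \<open>The space has as many points as \<open>K\<close>, so a labelling, being onto, is a
  bijection and sends distinct labels to distance \<open>c\<close>. Together with
  \<open>equilateral_in_gen\<close>, equilateral spaces thus detect the smallest off-diagonal bound
  in \<open>D\<close>.\<close>

lemma equilateral_in_genD:
  assumes c: "c > 0" and X: "equilateral K w c \<in> gen K w D" and ij: "i \<in> K" "j \<in> K" "i \<noteq> j"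
  shows "ereal c \<le> D i j"
proof -
  let ?X = "equilateral K w c"
  note d = Metric_space_equilateral[OF c]
  obtain F where F: "is_mm ?X" "fits K w ?X F"
      "\<forall>i\<in>K. \<forall>j\<in>K. ereal (mdist (fst ?X) (F i) (F j)) \<le> D i j"
    using X by (rule genE)
  have "K = F ` K"
    using fits_surj[OF F(1,2)] mspace_finite_mm[OF d] by (simp add: equilateral_def)
  then have "inj_on F K"
    using finite_K by (intro eq_card_imp_inj_on) auto
  then have "F i \<noteq> F j" using ij by (auto dest: inj_onD)
  then show ?thesis
    using F(3)[rule_format, OF ij(1,2)] mdist_finite_mm[OF d] by (simp add: equilateral_def)
qed

lemma card_mspace_gen:
  assumes "X \<in> gen K w D"
  shows "card (mspace (fst X)) \<le> card K"
proof -
  obtain F where "is_mm X" "fits K w X F" using assms by (rule genE)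
  then show ?thesis using fits_surj finite_K by (simp add: card_image_le)
qed

text \<open>Scaling by 2 moves the largest equilateral copy of K, so the pyramid is not a fixed point.\<close>

lemma gen_in_Pi_star:
  assumes c: "c > 0" and D: "\<And>i. i \<in> K \<Longrightarrow> 0 \<le> D i i"
      "\<And>i j. i \<in> K \<Longrightarrow> j \<in> K \<Longrightarrow> i \<noteq> j \<Longrightarrow> ereal c \<le> D i j"
    and ij: "i \<in> K" "j \<in> K" "i \<noteq> j" "D i j = ereal c"
  shows "gen K w D \<in> Pi_star"
proof -
  have "pyramid (gen K w D)" by (rule pyramid_gen[OF c D(2,1)])
  moreover have "scale_pyr 2 (gen K w D) \<noteq> gen K w D"
  proof
    assume eq: "scale_pyr 2 (gen K w D) = gen K w D"
    have "equilateral K w (2 * c) \<in> gen K w (\<lambda>i j. ereal 2 * D i j)"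
    proof (rule equilateral_in_gen)
      fix i j assume "i \<in> K" "j \<in> K" "i \<noteq> j"
      from ereal_mult_left_mono[OF D(2)[OF this], of "ereal 2"]
      show "ereal (2 * c) \<le> ereal 2 * D i j" by simp
    qed (use c D(1) in \<open>auto intro: ereal_0_le_mult\<close>)
    then have "equilateral K w (2 * c) \<in> gen K w D"
      using scale_pyr_gen[of 2 K w D] eq by simp
    from equilateral_in_genD[OF _ this ij(1,2,3)] c ij(4) show False by simp
  qed
  moreover have "(2::real) > 0" by simp
  ultimately show ?thesis unfolding Pi_star_def Fix_Pi_def Pyramids_def by blast
qed

end

section \<open>The two limits\<close>

definition triangles :: "ereal \<Rightarrow> ereal \<Rightarrow> mm set" where
  "triangles a b = gen {0, 1, 2} (\<lambda>_. 1/3) (\<lambda>i j. if i = j then 0 else if i \<noteq> 2 \<and> j \<noteq> 2 then a else b)"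

definition segments :: "ereal \<Rightarrow> mm set" where
  "segments c = gen {0, 1} (\<lambda>i. if i = 0 then 2/3 else 1/3) (\<lambda>i j. if i = j then 0 else c)"

interpretation tri: weights "{0, 1, 2}" "\<lambda>_. 1/3"
  by unfold_locales auto

interpretation seg: weights "{0, 1}" "\<lambda>i. if i = 0 then 2/3 else 1/3"
  by unfold_locales auto

lemma scale_pyr_triangles: "t > 0 \<Longrightarrow> scale_pyr t (triangles a b) = triangles (ereal t * a) (ereal t * b)"
  unfolding triangles_def scale_pyr_gen by (rule arg_cong[of _ _ "gen _ _"]) (auto simp: fun_eq_iff)

lemma scale_pyr_segments: "t > 0 \<Longrightarrow> scale_pyr t (segments c) = segments (ereal t * c)"
  unfolding segments_def scale_pyr_gen by (rule arg_cong[of _ _ "gen _ _"]) (auto simp: fun_eq_iff)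

lemma triangles_in_Pi_star:
  assumes "a > 0" "ereal a \<le> b"
  shows "triangles (ereal a) b \<in> Pi_star"
  unfolding triangles_def
  by (rule tri.gen_in_Pi_star[OF assms(1), where i = 0 and j = 1]) (use assms in auto)

lemma segments_in_Pi_star: "segments 1 \<in> Pi_star"
  unfolding segments_def
  by (rule seg.gen_in_Pi_star[of 1, where i = 0 and j = 1]) (auto simp: one_ereal_def)

lemma triangles_mono: "X \<in> triangles a b \<Longrightarrow> a \<le> a' \<Longrightarrow> b \<le> b' \<Longrightarrow> X \<in> triangles a' b'"
  unfolding triangles_def by (erule gen_mono) auto

lemma Pi_star_pyramid: "P \<in> Pi_star \<Longrightarrow> pyramid P"
  by (simp add: Pi_star_def Pyramids_def)

text \<open>With the sum unrolled, merging two labels becomes arithmetic on masses, 1/3 + 1/3 = 2/3,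
  decided by case distinction.\<close>

lemma fits_triangles_iff:
  "fits {0, 1, 2} (\<lambda>_. 1/3) X F \<longleftrightarrow>
     (F 0 \<in> mspace (fst X) \<and> F 1 \<in> mspace (fst X) \<and> F 2 \<in> mspace (fst X)) \<and>
     (\<forall>A\<in>sets (snd X). measure (snd X) A =
        (if F 0 \<in> A then 1/3 else 0) + ((if F 1 \<in> A then 1/3 else 0) + (if F 2 \<in> A then 1/3 else 0)))"
proof -
  have "(\<Sum>i\<in>{i\<in>{0, 1, 2}. F i \<in> A}. 1/3) =
      (if F 0 \<in> A then 1/3 else 0) + ((if F 1 \<in> A then 1/3 else 0) + (if F 2 \<in> A then 1/3 else 0 :: real))" for A
    by (subst sum.inter_filter) simp_all
  note sum = this
  show ?thesis unfolding fits_def sum by (intro arg_cong2[of _ _ _ _ "(\<and>)"] refl) auto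
qed

lemma fits_segments_iff:
  "fits {0, 1} (\<lambda>i. if i = 0 then 2/3 else 1/3) X F \<longleftrightarrow>
     (F 0 \<in> mspace (fst X) \<and> F 1 \<in> mspace (fst X)) \<and>
     (\<forall>A\<in>sets (snd X). measure (snd X) A = (if F 0 \<in> A then 2/3 else 0) + (if F 1 \<in> A then 1/3 else 0))"
proof -
  have "(\<Sum>i\<in>{i\<in>{0, 1}. F i \<in> A}. if i = 0 then 2/3 else 1/3) =
      (if F 0 \<in> A then 2/3 else 0) + (if F 1 \<in> A then 1/3 else 0 :: real)" for A
    by (subst sum.inter_filter) simp_all
  note sum = this
  show ?thesis unfolding fits_def sum by (intro arg_cong2[of _ _ _ _ "(\<and>)"] refl) auto
qed

lemma segments_subset_triangles:
  assumes X: "X \<in> segments c" and a: "0 \<le> a"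
  shows "X \<in> triangles a c"
proof -
  obtain F where Xm: "is_mm X" and F: "fits {0, 1} (\<lambda>i. if i = 0 then 2/3 else 1/3) X F"
      "\<forall>i\<in>{0, 1}. \<forall>j\<in>{0, 1}. ereal (mdist (fst X) (F i) (F j)) \<le> (if i = j then 0 else c)"
    using X unfolding segments_def by (rule genE)
  have m: "F 0 \<in> mspace (fst X)" "F 1 \<in> mspace (fst X)" using F(1) by (auto simp: fits_def)
  \<comment> \<open>Labels 0 and 1 both go to the point of label mass 2/3, label 2 to the other one.
    The distance between the first two is 0, so any nonnegative \<open>a\<close> bounds it.\<close>
  define G where "G i = F (if i = 2 then 1 else 0)" for i :: real
  have fit: "fits {0, 1, 2} (\<lambda>_. 1/3) X G"
    using F(1) unfolding fits_triangles_iff fits_segments_iff by (auto simp: G_def)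
  have le: "ereal (mdist (fst X) (G i) (G j)) \<le> (if i = j then 0 else if i \<noteq> 2 \<and> j \<noteq> 2 then a else c)"
    if "i \<in> {0, 1, 2}" "j \<in> {0, 1, 2}" for i j
    using F(2)[rule_format, of 0 1] F(2)[rule_format, of 1 0] mdist_zero[OF m(1,1)] mdist_zero[OF m(2,2)] a
    by (auto simp: G_def simp flip: zero_ereal_def)
  show ?thesis unfolding triangles_def by (rule genI[OF Xm fit le])
qed

text \<open>The labelling varies with \<open>n\<close>, but the separation \<open>r\<close> of the
  finite space \<open>X\<close> does not and can be fixed first. Once \<open>1 / Suc n < r\<close>,
  the labels 0 and 1 fall on one point and their masses add up.\<close>

lemma segments_of_triangles:
  assumes X: "\<And>n. X \<in> triangles (ereal (1 / Suc n)) c"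
  shows "X \<in> segments c"
proof -
  have Xm: "is_mm X" using X[of 0] by (simp add: triangles_def gen_def)
  obtain F0 where "fits {0, 1, 2} (\<lambda>_. 1/3) X F0" using X[of 0] unfolding triangles_def by (rule genE)
  then have "finite (mspace (fst X))" using tri.fits_surj[OF Xm] by simp
  then obtain r where r: "r > 0"
      "\<And>x y. x \<in> mspace (fst X) \<Longrightarrow> y \<in> mspace (fst X) \<Longrightarrow> x \<noteq> y \<Longrightarrow> r \<le> mdist (fst X) x y"
    using finite_separated[OF _ subset_refl] by blast
  obtain n where n: "1 / real (Suc n) < r"
    using reals_Archimedean[OF r(1)] by (auto simp: inverse_eq_divide)
  obtain F where F: "fits {0, 1, 2} (\<lambda>_. 1/3) X F"
      "\<forall>i\<in>{0, 1, 2}. \<forall>j\<in>{0, 1, 2}. ereal (mdist (fst X) (F i) (F j)) \<le>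
          (if i = j then 0 else if i \<noteq> 2 \<and> j \<noteq> 2 then ereal (1 / Suc n) else c)"
    using X[of n] unfolding triangles_def by (rule genE)
  have m: "F 0 \<in> mspace (fst X)" "F 1 \<in> mspace (fst X)" "F 2 \<in> mspace (fst X)"
    using F(1) by (auto simp: fits_def)
  have "mdist (fst X) (F 0) (F 1) \<le> 1 / Suc n" using F(2)[rule_format, of 0 1] by simp
  then have eq: "F 1 = F 0" using r(2)[OF m(1,2)] n by force
  define G where "G i = F (if i = 0 then 0 else 2)" for i :: real
  have fit: "fits {0, 1} (\<lambda>i. if i = 0 then 2/3 else 1/3) X G"
    using F(1) unfolding fits_triangles_iff fits_segments_iff by (auto simp: G_def eq)
  have le: "ereal (mdist (fst X) (G i) (G j)) \<le> (if i = j then 0 else c)"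
    if "i \<in> {0, 1}" "j \<in> {0, 1}" for i j
    using F(2)[rule_format, of 0 2] F(2)[rule_format, of 2 0] mdist_zero[OF m(1,1)] mdist_zero[OF m(3,3)] that
    by (auto simp: G_def simp flip: zero_ereal_def)
  show ?thesis unfolding segments_def by (rule genI[OF Xm fit le])
qed

text \<open>The sequence decreases, with intersection \<open>segments 1\<close>. A space outside the
  limit is missed by some member, and this member, containing all later ones, is the separating
  pyramid.\<close>

lemma weak_conv_triangles_segments: "weak_conv (\<lambda>n. triangles (ereal (1 / Suc n)) 1) (segments 1)"
proof (rule weak_convI)
  show pyr: "pyramid (triangles (ereal (1 / Suc n)) 1)" for n
    by (intro Pi_star_pyramid triangles_in_Pi_star) (auto simp: one_ereal_def)
  show "\<forall>\<^sub>F n in sequentially. X \<in> triangles (ereal (1 / Suc n)) 1" if "X \<in> segments 1" for X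
    using segments_subset_triangles[OF that] by (intro always_eventually allI) simp
  show "\<exists>Q. pyramid Q \<and> X \<notin> Q \<and> (\<forall>\<^sub>F n in sequentially. triangles (ereal (1 / Suc n)) 1 \<subseteq> Q)"
    if X: "X \<notin> segments 1" for X
  proof -
    obtain N where N: "X \<notin> triangles (ereal (1 / Suc N)) 1"
      using segments_of_triangles[of X 1] X by blast
    have "triangles (ereal (1 / Suc n)) 1 \<subseteq> triangles (ereal (1 / Suc N)) 1" if "N \<le> n" for n
    proof
      fix Y assume "Y \<in> triangles (ereal (1 / Suc n)) 1"
      then show "Y \<in> triangles (ereal (1 / Suc N)) 1"
        by (rule triangles_mono) (use that in \<open>simp_all add: frac_le\<close>)
    qed
    then have "\<forall>\<^sub>F n in sequentially. triangles (ereal (1 / Suc n)) 1 \<subseteq> triangles (ereal (1 / Suc N)) 1"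
      unfolding eventually_sequentially by blast
    with N pyr show ?thesis by blast
  qed
qed

text \<open>The sequence increases. Each space in the limit has finitely many points, hence finite
  diameter, and so belongs to all late members; the limit itself is the separating pyramid.\<close>

lemma weak_conv_triangles_infinite: "weak_conv (\<lambda>n. triangles 1 (ereal (Suc n))) (triangles 1 \<infinity>)"
proof (rule weak_convI)
  show "pyramid (triangles 1 (ereal (Suc n)))" for n
    unfolding one_ereal_def by (intro Pi_star_pyramid triangles_in_Pi_star) auto
  have pyr: "pyramid (triangles 1 \<infinity>)"
    unfolding one_ereal_def by (intro Pi_star_pyramid triangles_in_Pi_star) auto
  show "\<forall>\<^sub>F n in sequentially. X \<in> triangles 1 (ereal (Suc n))" if X: "X \<in> triangles 1 \<infinity>" for X
  proof -
    obtain F where Xm: "is_mm X" and F: "fits {0, 1, 2} (\<lambda>_. 1/3) X F"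
        "\<forall>i\<in>{0, 1, 2}. \<forall>j\<in>{0, 1, 2}. ereal (mdist (fst X) (F i) (F j)) \<le>
            (if i = j then 0 else if i \<noteq> 2 \<and> j \<noteq> 2 then 1 else \<infinity>)"
      using X unfolding triangles_def by (rule genE)
    define c where "c = Max ((\<lambda>(i, j). mdist (fst X) (F i) (F j)) ` ({0, 1, 2} \<times> {0, 1, 2}))"
    obtain N :: nat where N: "c \<le> real N" using real_arch_simple by blast
    have "X \<in> triangles 1 (ereal (Suc n))" if n: "N \<le> n" for n
    proof -
      have bound: "mdist (fst X) (F i) (F j) \<le> real (Suc n)" if "i \<in> {0, 1, 2}" "j \<in> {0, 1, 2}" for i j
      proof -
        have "mdist (fst X) (F i) (F j) \<le> c"
          unfolding c_def
        proof (rule Max_ge)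
          have "(i, j) \<in> {0, 1, 2} \<times> {0, 1, 2}" using that by (rule SigmaI)
          then have "(\<lambda>(i, j). mdist (fst X) (F i) (F j)) (i, j)
              \<in> (\<lambda>(i, j). mdist (fst X) (F i) (F j)) ` ({0, 1, 2} \<times> {0, 1, 2})"
            by (rule imageI)
          then show "mdist (fst X) (F i) (F j) \<in> (\<lambda>(i, j). mdist (fst X) (F i) (F j)) ` ({0, 1, 2} \<times> {0, 1, 2})"
            unfolding prod.case .
        qed simp
        then show ?thesis using N n by simp
      qed
      have le: "ereal (mdist (fst X) (F i) (F j)) \<le>
            (if i = j then 0 else if i \<noteq> 2 \<and> j \<noteq> 2 then 1 else ereal (Suc n))"
        if "i \<in> {0, 1, 2}" "j \<in> {0, 1, 2}" for i j
        using F(2)[rule_format, OF that] bound[OF that] by (smt (verit) ereal_less_eq(3))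
      show ?thesis unfolding triangles_def by (rule genI[OF Xm F(1) le])
    qed
    then show ?thesis unfolding eventually_sequentially by blast
  qed
  have "triangles 1 (ereal (Suc n)) \<subseteq> triangles 1 \<infinity>" for n
    using triangles_mono[of _ 1 "ereal (Suc n)" 1 \<infinity>] by auto
  then show "\<exists>Q. pyramid Q \<and> X \<notin> Q \<and> (\<forall>\<^sub>F n in sequentially. triangles 1 (ereal (Suc n)) \<subseteq> Q)"
    if "X \<notin> triangles 1 \<infinity>" for X
    using that pyr by (intro exI[of _ "triangles 1 \<infinity>"]) simp
qed

lemma orbit_triangles: "orbit (triangles (ereal (1 / Suc n)) 1) = orbit (triangles 1 (ereal (Suc n)))"
proof -
  have "triangles (ereal (1 / Suc n)) 1 = scale_pyr (1 / Suc n) (triangles 1 (ereal (Suc n)))"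
    by (simp add: scale_pyr_triangles one_ereal_def)
  then show ?thesis by (simp add: orbit_scale_pyr)
qed

text \<open>Every scaled copy of \<open>segments 1\<close> consists of spaces with at most two
  points, whereas \<open>triangles 1 \<infinity>\<close> contains an equilateral triangle.\<close>

lemma triangles_not_in_orbit: "triangles 1 \<infinity> \<notin> orbit (segments 1)"
proof
  assume "triangles 1 \<infinity> \<in> orbit (segments 1)"
  then obtain t where "t > 0" "triangles 1 \<infinity> = scale_pyr t (segments 1)" unfolding orbit_def by blast
  then have eq: "triangles 1 \<infinity> = segments (ereal t)" by (simp add: scale_pyr_segments)
  let ?X = "equilateral {0, 1, 2} (\<lambda>_. 1/3) 1"
  have "?X \<in> triangles 1 \<infinity>"
    unfolding triangles_def by (rule tri.equilateral_in_gen) (auto simp: one_ereal_def)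
  then have "card (mspace (fst ?X)) \<le> card {0, 1 :: real}"
    unfolding eq segments_def by (rule seg.card_mspace_gen)
  moreover have "mspace (fst ?X) = {0, 1, 2}"
    using tri.mspace_finite_mm[OF tri.Metric_space_equilateral[of 1]] by (simp add: equilateral_def)
  ultimately show False by simp
qed

section \<open>The quotient by scaling and the contradiction\<close>

lemma topspace_Pi_star_top: "topspace Pi_star_top = Pi_star"
  by (auto simp: Pi_star_top_def topspace_weak_topology Pi_star_def)

lemma openin_quotient_topology: "openin (quotient_topology X f) = quot_open X f"
  unfolding quotient_topology_def by (rule topology_inverse'[OF istopology_quot_open])

lemma topspace_quotient_topology: "topspace (quotient_topology X f) = f ` topspace X"
proof -
  have "{x \<in> topspace X. f x \<in> f ` topspace X} = topspace X" by blast
  then have "quot_open X f (f ` topspace X)" unfolding quot_open_def by simp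
  then have "f ` topspace X \<subseteq> topspace (quotient_topology X f)"
    by (intro openin_subset) (simp only: openin_quotient_topology)
  moreover have "quot_open X f (topspace (quotient_topology X f))"
    using openin_topspace[of "quotient_topology X f"] by (simp only: openin_quotient_topology)
  then have "topspace (quotient_topology X f) \<subseteq> f ` topspace X"
    unfolding quot_open_def by (rule conjunct1)
  ultimately show ?thesis by (rule equalityI[rotated])
qed

lemma continuous_map_quotient_topology: "continuous_map X (quotient_topology X f) f"
  unfolding continuous_map_def topspace_quotient_topology openin_quotient_topology quot_open_def by auto

text \<open>The quotient map is continuous, so any choice of representatives may witness convergence
  of orbits; the two sequences of triangles choose differently from the same orbits.\<close>

lemma limitin_orbit:
  assumes "\<And>n. Ps n \<in> Pi_star" "P \<in> Pi_star" "weak_conv Ps P"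
  shows "limitin Pi_star_mod_R (\<lambda>n. orbit (Ps n)) (orbit P) sequentially"
proof -
  have "limitin weak_topology Ps P sequentially"
    using assms by (intro limitin_of_weak_conv) (auto simp: Pi_star_def)
  then have "limitin Pi_star_top Ps P sequentially"
    using assms(1,2) unfolding Pi_star_top_def limitin_subtopology by simp
  from continuous_map_limit[OF continuous_map_quotient_topology this, of orbit]
  show ?thesis by (simp add: Pi_star_mod_R_def comp_def)
qed

lemma Pi_star_top_limit_unique:
  assumes "limitin Pi_star_top xs x sequentially" "limitin Pi_star_top xs y sequentially"
    and "\<And>n. xs n \<in> Pi_star"
  shows "x = y"
  using assms topological_limit_unique[of xs x y]
  by (auto simp: Pi_star_top_def limitin_subtopology Pi_star_def)

theorem theorem3p5:
  shows "\<not> (Pi_star_top homeomorphic_space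
             prod_topology Pi_star_mod_R (subtopology euclideanreal {0<..}))"
proof
  let ?Y = "prod_topology Pi_star_mod_R (subtopology euclideanreal {0<..})"
  assume "Pi_star_top homeomorphic_space ?Y"
  then obtain f g where "homeomorphic_maps Pi_star_top ?Y f g"
    unfolding homeomorphic_space_def by blast
  then have g: "continuous_map ?Y Pi_star_top g" "\<And>y. y \<in> topspace ?Y \<Longrightarrow> f (g y) = y"
    unfolding homeomorphic_maps_def by auto
  define xs where "xs n = (orbit (triangles 1 (ereal (Suc n))), 1::real)" for n
  have T: "triangles 1 (ereal (Suc n)) \<in> Pi_star" "triangles (ereal (1 / Suc n)) 1 \<in> Pi_star" for n
    using triangles_in_Pi_star[of 1 "ereal (Suc n)"] triangles_in_Pi_star[of "1 / Suc n" 1]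
    by (auto simp: one_ereal_def)
  have T_inf: "triangles 1 \<infinity> \<in> Pi_star"
    using triangles_in_Pi_star[of 1 \<infinity>] by (simp add: one_ereal_def)
  have one: "limitin (subtopology euclideanreal {0<..}) (\<lambda>n. 1::real) 1 sequentially"
    by (simp add: limitin_const)
  have lim1: "limitin ?Y xs (orbit (triangles 1 \<infinity>), 1) sequentially"
    using limitin_orbit[OF T(1) T_inf weak_conv_triangles_infinite] one
    by (simp add: limitin_pairwise xs_def comp_def)
  \<comment> \<open>\<open>orbit_triangles\<close> turns the orbits of the rescaled triangles into
    those of the original ones, so this is again the sequence \<open>xs\<close>.\<close>
  have lim2: "limitin ?Y xs (orbit (segments 1), 1) sequentially"
    using limitin_orbit[OF T(2) segments_in_Pi_star weak_conv_triangles_segments] one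
    unfolding orbit_triangles by (simp add: limitin_pairwise xs_def comp_def)
  have "xs n \<in> topspace ?Y" for n
    using T(1)[of n] by (simp add: xs_def Pi_star_mod_R_def topspace_quotient_topology topspace_Pi_star_top)
  then have "(g \<circ> xs) n \<in> Pi_star" for n
    using continuous_map_funspace[OF g(1)] by (auto simp: topspace_Pi_star_top)
  \<comment> \<open>The continuous inverse \<open>g\<close> sends both limits of \<open>xs\<close>
    to limits of one sequence in \<open>Pi_star_top\<close>, which must coincide; applying
    \<open>f\<close> brings the equality back to the orbits.\<close>
  then have "g (orbit (triangles 1 \<infinity>), 1) = g (orbit (segments 1), 1)"
    by (rule Pi_star_top_limit_unique[OF continuous_map_limit[OF g(1) lim1] continuous_map_limit[OF g(1) lim2]])
  then have "orbit (triangles 1 \<infinity>) = orbit (segments 1)"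
    using g(2)[OF limitin_topspace[OF lim1]] g(2)[OF limitin_topspace[OF lim2]] by (metis prod.inject)
  then show False using self_in_orbit triangles_not_in_orbit by metis
qed

end
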